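(* Let $M\ge 4$ be an even integer congruent to $1$ or $4$ modulo $5$, and let $N\ge 1$, $k\ge 0$, $j\ge 0$ be integers. The number of partitions of $N$ into parts congruent to $1$ or $4$ modulo $5$ with exactly $k$ parts equal to $M$ and exactly $j$ parts equal to $1$ is equal to the number of partitions $\lambda\in\mathsf{Diff_2}$ of $N$ such that one of the following holds: (1) $\lambda$ consists of exactly one part, of size $N=j$, and $k=0$; (2) $\lambda$ has exactly two parts, and $col(\lambda)=2^{\ell}1^j$, where either $\ell=Mk/2+i$ for some $0\le i\le M/2-1$ with $i\neq M/2-2$ (where $k\ge 0$), or $\ell=Mk/2-2$ (where $k\ge 1$); (3) $\lambda$ has between three and $M-1$ parts (inclusive), and $col(\lambda)$ has exactly $j$ $1$'s and between $Mk/2$ and $Mk/2+M/2-1$ (inclusive) $2$'s; (4) $\lambda$ has at least $M$ parts, and $col(\lambda)$ has exactly $j$ $1$'s and exactly $k$ $M$'s.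
   Context: Partitions are written with weakly decreasing positive parts; $2^{\ell}1^j$ denotes the partition with $\ell$ parts equal to $2$ and $j$ parts equal to $1$. $\mathsf{Diff_2}$ is the set of partitions $\lambda=(\lambda_1,\dots,\lambda_m)$ whose consecutive differences are at least two, i.e. $\lambda_i-\lambda_{i+1}\ge 2$ for $1\le i<m$. For $\lambda=(\lambda_1,\dots,\lambda_m)\in\mathsf{Diff_2}$, $col(\lambda)$ is the partition formed by the columns of (i.e. the conjugate of) $(\lambda_1-(2m-1),\lambda_2-(2m-3),\dots,\lambda_m-1)$, where zero entries are ignored. Example: $col((16,12,7,4,1))=(7,5,2,1,0)^T=(4,3,2,2,2,1,1)$. *)

theory Defs
  imports Main
begin

definition is_partition :: "nat list \<Rightarrow> bool" where
  "is_partition xs \<longleftrightarrow> sorted_wrt (\<ge>) xs \<and> (\<forall>x\<in>set xs. 0 < x)"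

definition partitions :: "nat \<Rightarrow> nat list set" where
  "partitions n = {xs. is_partition xs \<and> sum_list xs = n}"

definition Diff2 :: "nat list set" where
  "Diff2 = {xs. is_partition xs \<and> (\<forall>i. Suc i < length xs \<longrightarrow> xs ! Suc i + 2 \<le> xs ! i)}"

(* Column c (counted from 0) has one cell for every row of length greater than c,
   so zero rows contribute nothing. *)
definition conjugate :: "nat list \<Rightarrow> nat list" where
  "conjugate xs = map (\<lambda>c. length (filter (\<lambda>x. c < x) xs)) [0..<Max (insert 0 (set xs))]"

(* With m = length xs, the 0-indexed entry i is reduced by 2m - 1 - 2i. The truncated
   subtraction is exact on Diff2, see Diff2_nth_ge. *)
definition col :: "nat list \<Rightarrow> nat list" where
  "col xs = conjugate (map (\<lambda>i. xs ! i - (2 * (length xs - i) - 1)) [0..<length xs])"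

lemma Diff2_nth_ge:
  assumes xs: "xs \<in> Diff2" and i: "i < length xs"
  shows "2 * (length xs - i) - 1 \<le> xs ! i"
proof -
  have "i < length xs \<longrightarrow> 2 * (length xs - i) - 1 \<le> xs ! i"
    using less_imp_le[OF i]
  proof (induction i rule: inc_induct)
    case base
    then show ?case by simp
  next
    case (step n)
    show ?case
    proof (cases "Suc n < length xs")
      case True
      with xs have "xs ! Suc n + 2 \<le> xs ! n" by (simp add: Diff2_def)
      with step True show ?thesis by linarith
    next
      case False
      with step have "Suc n = length xs" by linarith
      moreover from step xs have "0 < xs ! n"
        by (simp add: Diff2_def is_partition_def)
      ultimately show ?thesis by linarith
    qed
  qed
  with i show ?thesis by blast
qed

lemma finite_partitions: "finite (partitions n)"
proof (rule finite_subset)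
  have len: "length xs \<le> sum_list xs" if "\<forall>x\<in>set xs. 0 < x" for xs :: "nat list"
    using that by (induction xs) auto
  show "partitions n \<subseteq> {xs. set xs \<subseteq> {..n} \<and> length xs \<le> n}"
    using len by (auto simp: partitions_def is_partition_def member_le_sum_list)
  show "finite {xs. set xs \<subseteq> {..n} \<and> length xs \<le> n}"
    by (rule finite_lists_length_le) simp
qed

lemma "col [16, 12, 7, 4, 1] = [4, 3, 2, 2, 2, 1, 1]"
  by code_simp

end

(* Fixing k and j in the generating function of partitions into parts 1 or 4 modulo 5 multiplies the
   Rogers-Ramanujan product by W = q^(j + k M) (1 - q) (1 - q^M).  On the sum side, the partitions
   in Diff2 with m parts correspond through col to q^(m^2) / (q; q)_m.  Multiplying by W prescribes the
   number of 1s and of Ms if m >= M; if 3 <= m < M, the identity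
   q^(k M) (1 - q^M) = (1 - q^2) (q^(k M) + q^(k M + 2) + ... + q^(k M + M - 2)) shows that it prescribes
   the number of 1s and an interval for the number of 2s instead.  The terms m = 0 and m = 1 add
   up to q^(j + k M) (1 - q^M); this is the single partition of case (1) if k = 0, together with the
   exchange of l = M k / 2 + M / 2 - 2 for l = M k / 2 - 2 in case (2).

   The Rogers-Ramanujan identity itself is obtained by Bressoud's method: a q-Vandermonde identity
   gives a Bailey step which raises the exponents of a theta-like sum by n^2; two such steps lead from
   a vanishing instance of the finite Jacobi triple product to the finite identity, and the limit
   is another instance of the triple product. *)
theory Submission
  imports Defs "HOL-Library.Multiset" "HOL-Computational_Algebra.Formal_Power_Series"
begin

subsection \<open>Finite q-series identities\<close>

lemma choose_two_Suc: "Suc m choose 2 = (m choose 2) + m"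
  by (simp add: numeral_2_eq_2)

text \<open>Here \<open>r n\<close> stands for the inverse of the \<open>q\<close>-factorial \<open>(1 - q) * \<dots> * (1 - q ^ n)\<close>.\<close>

locale q_factorial_inverse =
  fixes q :: "'a :: idom" and r :: "nat \<Rightarrow> 'a"
  assumes r_0 [simp]: "r 0 = 1"
    and r_Suc: "r (Suc n) * (1 - q ^ Suc n) = r n"
begin

lemma r_mult_prod: "r n * (\<Prod>i<n. 1 - q ^ Suc i) = 1"
proof (induction n)
  case (Suc n)
  have "r (Suc n) * (\<Prod>i<Suc n. 1 - q ^ Suc i) = (r (Suc n) * (1 - q ^ Suc n)) * (\<Prod>i<n. 1 - q ^ Suc i)"
    by (simp add: mult_ac)
  then show ?case by (simp only: r_Suc Suc.IH)
qed simp

lemma r_nonzero: "r n \<noteq> 0"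
  using r_mult_prod[of n] by auto

lemma one_minus_power_nonzero: "1 - q ^ Suc n \<noteq> 0"
  using r_Suc[of n] r_nonzero[of n] by auto

text \<open>The product \<open>r m * r (n - m)\<close> is the Gaussian binomial divided by the
  q-factorial of n, and the rule is
  \<open>1 - q^(n+1) = (1 - q^(n-m)) + q^(n-m) * (1 - q^(m+1))\<close>. The conditional supplies a
  zero binomial at m = n, where truncated subtraction would yield \<open>r 0 = 1\<close>.\<close>

lemma q_pascal:
  assumes "m \<le> n"
  shows "(1 - q ^ Suc n) * (r (Suc m) * r (n - m)) =
    (if m < n then r (Suc m) * r (n - Suc m) else 0) + q ^ (n - m) * (r m * r (n - m))"
proof (cases "m < n")
  case True
  then obtain d where n: "n = m + Suc d" using less_natE[of m n] by auto
  have "(1 - q ^ Suc n) * (r (Suc m) * r (n - m)) =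
     r (Suc m) * (r (Suc d) * (1 - q ^ Suc d)) + q ^ Suc d * ((r (Suc m) * (1 - q ^ Suc m)) * r (Suc d))"
    by (simp add: n algebra_simps power_add)
  also have "\<dots> = r (Suc m) * r d + q ^ Suc d * (r m * r (Suc d))"
    by (simp only: r_Suc)
  finally show ?thesis by (simp add: n)
next
  case False
  with assms have "m = n" by simp
  then show ?thesis using r_Suc[of n] by (simp add: mult.commute)
qed

text \<open>From the other splitting,
  \<open>1 - q^(n+1) = q^(m+1) * (1 - q^(n-m)) + (1 - q^(m+1))\<close>.\<close>

lemma q_pascal_dual:
  assumes "m \<le> n"
  shows "(1 - q ^ Suc n) * (r (Suc m) * r (n - m)) =
    (if m < n then q ^ Suc m * (r (Suc m) * r (n - Suc m)) else 0) + r m * r (n - m)"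
proof (cases "m < n")
  case True
  then obtain d where n: "n = m + Suc d" using less_natE[of m n] by auto
  have "(1 - q ^ Suc n) * (r (Suc m) * r (n - m)) =
     q ^ Suc m * (r (Suc m) * (r (Suc d) * (1 - q ^ Suc d))) + (r (Suc m) * (1 - q ^ Suc m)) * r (Suc d)"
    by (simp add: n algebra_simps power_add)
  also have "\<dots> = q ^ Suc m * (r (Suc m) * r d) + r m * r (Suc d)"
    by (simp only: r_Suc)
  finally show ?thesis by (simp add: n)
next
  case False
  with assms have "m = n" by simp
  then show ?thesis using r_Suc[of n] by (simp add: mult.commute)
qed

lemma sum_shift_if:
  fixes f :: "nat \<Rightarrow> 'a"
  shows "f 0 + (\<Sum>m\<le>n. if m < n then f (Suc m) else 0) = (\<Sum>m\<le>n. f m)"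
proof -
  have "(\<Sum>m\<le>n. if m < n then f (Suc m) else 0) = (\<Sum>m<n. f (Suc m))"
    by (rule sum.mono_neutral_cong_right) auto
  then show ?thesis by (simp add: sum.atMost_shift)
qed

text \<open>Rothe's finite q-binomial theorem. Multiplied by \<open>1 - q^(n+1)\<close>, the sum for
  \<open>Suc n\<close> splits by the Pascal rule into \<open>b\<close> and \<open>a * q^n\<close>
  times the sum for \<open>n\<close>. The homogeneous variable \<open>b\<close> will become a power
  of \<open>q\<close>, which avoids negative powers in the triple product.\<close>

theorem q_binomial:
  "(\<Sum>m\<le>n. q ^ (m choose 2) * a ^ m * b ^ (n - m) * (r m * r (n - m))) = r n * (\<Prod>i<n. b + a * q ^ i)"
proof (induction n)
  case (Suc n)
  let ?t = "\<lambda>m. q ^ (m choose 2) * a ^ m * b ^ (n - m) * (r m * r (n - m))"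
  have head: "(1 - q ^ Suc n) * (b ^ Suc n * r (Suc n)) = b * ?t 0"
    using r_Suc[of n] by (simp add: mult_ac binomial_eq_0)
  have tail: "(1 - q ^ Suc n) * (q ^ (Suc m choose 2) * a ^ Suc m * b ^ (n - m) *
      (r (Suc m) * r (n - m)))
      = (if m < n then b * ?t (Suc m) else 0) + a * q ^ n * ?t m" if "m \<le> n" for m
  proof -
    have "(1 - q ^ Suc n) * (q ^ (Suc m choose 2) * a ^ Suc m * b ^ (n - m) * (r (Suc m) * r (n - m)))
      = q ^ (Suc m choose 2) * a ^ Suc m * b ^ (n - m) * ((1 - q ^ Suc n) * (r (Suc m) * r (n - m)))"
      by (simp add: mult_ac)
    also have "\<dots> = (if m < n then q ^ (Suc m choose 2) * a ^ Suc m * b ^ (n - m) *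
        (r (Suc m) * r (n - Suc m)) else 0)
        + q ^ (Suc m choose 2) * a ^ Suc m * b ^ (n - m) * (q ^ (n - m) * (r m * r (n - m)))"
      unfolding q_pascal[OF that] by (simp add: distrib_left)
    also have "q ^ (Suc m choose 2) * a ^ Suc m * b ^ (n - m) * (q ^ (n - m) * (r m * r (n - m)))
        = a * (q ^ m * q ^ (n - m)) * ?t m"
      by (simp add: choose_two_Suc power_add mult_ac)
    also have "q ^ m * q ^ (n - m) = q ^ n"
      using that by (simp flip: power_add)
    also have "m < n \<Longrightarrow> b ^ (n - m) = b * b ^ (n - Suc m)"
      by (simp flip: power_Suc add: Suc_diff_Suc)
    then have "(if m < n then q ^ (Suc m choose 2) * a ^ Suc m * b ^ (n - m) *
        (r (Suc m) * r (n - Suc m)) else 0)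
      = (if m < n then b * ?t (Suc m) else 0)"
      by (auto simp: mult_ac)
    finally show ?thesis .
  qed
  have "(1 - q ^ Suc n) * (\<Sum>m\<le>Suc n. q ^ (m choose 2) * a ^ m * b ^ (Suc n - m) * (r m * r (Suc n - m)))
    = (1 - q ^ Suc n) * (b ^ Suc n * r (Suc n)) + (\<Sum>m\<le>n. (1 - q ^ Suc n) *
        (q ^ (Suc m choose 2) * a ^ Suc m * b ^ (n - m) * (r (Suc m) * r (n - m))))"
    unfolding sum.atMost_Suc_shift distrib_left sum_distrib_left by (simp add: binomial_eq_0)
  also have "\<dots> = (b * ?t 0 + (\<Sum>m\<le>n. if m < n then b * ?t (Suc m) else 0)) + (\<Sum>m\<le>n. a * q ^ n * ?t m)"
    unfolding head using tail by (simp add: sum.distrib add.assoc)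
  also have "\<dots> = (\<Sum>m\<le>n. b * ?t m) + (\<Sum>m\<le>n. a * q ^ n * ?t m)"
    by (subst sum_shift_if[of "\<lambda>m. b * ?t m" n]) (rule refl)
  also have "\<dots> = (b + a * q ^ n) * (\<Sum>m\<le>n. ?t m)"
    unfolding distrib_right sum_distrib_left sum.distrib ..
  also have "\<dots> = (r (Suc n) * (1 - q ^ Suc n)) * ((b + a * q ^ n) * (\<Prod>i<n. b + a * q ^ i))"
    unfolding Suc.IH r_Suc by (simp add: mult_ac)
  also have "\<dots> = (1 - q ^ Suc n) * (r (Suc n) * (\<Prod>i<Suc n. b + a * q ^ i))"
    by (simp add: mult_ac)
  finally show ?case
    using one_minus_power_nonzero[of n] by (simp only: mult_cancel_left) simp
qed (simp add: binomial_eq_0)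

text \<open>Induction with \<open>c\<close> arbitrary: after multiplication by
  \<open>1 - q^(n+1)\<close> the dual Pascal rule splits each term, and the regrouped pieces form
  the sum for \<open>n\<close> and \<open>Suc c\<close>.\<close>

theorem q_vandermonde:
  "(\<Sum>t\<le>n. q ^ (t * (t + c)) * (r t * r (n - t)) * r (t + c)) = r n * r (n + c)"
proof (induction n arbitrary: c)
  case (Suc n)
  let ?u = "\<lambda>t. q ^ (t * Suc (t + c)) * (r t * r (n - t)) * r (t + c)"
  let ?v = "\<lambda>t. q ^ (Suc t * Suc (t + c)) * (r t * r (n - t)) * r (Suc (t + c))"
  have head: "(1 - q ^ Suc n) * (r (Suc n) * r c) = ?u 0"
    using r_Suc[of n] by (simp add: mult_ac)
  have tail: "(1 - q ^ Suc n) * (q ^ (Suc t * (Suc t + c)) * (r (Suc t) * r (n - t)) * r (Suc t + c))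
      = (if t < n then ?u (Suc t) else 0) + ?v t" if "t \<le> n" for t
  proof -
    have "(1 - q ^ Suc n) * (q ^ (Suc t * (Suc t + c)) * (r (Suc t) * r (n - t)) * r (Suc t + c))
      = q ^ (Suc t * (Suc t + c)) * r (Suc t + c) * ((1 - q ^ Suc n) * (r (Suc t) * r (n - t)))"
      by (simp only: mult_ac)
    also have "\<dots> = (if t < n then q ^ (Suc t * (Suc t + c)) * q ^ Suc t *
        (r (Suc t) * r (n - Suc t)) * r (Suc t + c) else 0) + ?v t"
      unfolding q_pascal_dual[OF that] by (simp add: distrib_left mult_ac)
    also have "q ^ (Suc t * (Suc t + c)) * q ^ Suc t = q ^ (Suc t * Suc (Suc t + c))"
      unfolding power_add[symmetric] by (rule arg_cong[where f = "power q"]) (simp add: algebra_simps)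
    finally show ?thesis .
  qed
  \<comment> \<open>Both terms contain \<open>q^(t*(t+c+1))\<close>. Writing \<open>r (t+c)\<close>
    as \<open>r (t+c+1) * (1 - q^(t+c+1))\<close> makes the subtracted power cancel the extra power
    in \<open>?v t\<close>.\<close>
  have uv: "?u t + ?v t = q ^ (t * (t + Suc c)) * (r t * r (n - t)) * r (t + Suc c)" for t
  proof -
    have "?u t + ?v t = q ^ (t * Suc (t + c)) * (r t * r (n - t)) *
        (r (Suc (t + c)) * (1 - q ^ Suc (t + c)) + r (Suc (t + c)) * q ^ Suc (t + c))"
      unfolding r_Suc mult_Suc[of t] power_add by (simp only: distrib_left mult_ac)
    also have "r (Suc (t + c)) * (1 - q ^ Suc (t + c)) + r (Suc (t + c)) * q ^ Suc (t + c) =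
        r (t + Suc c)"
      by (simp flip: distrib_left del: power_Suc)
    finally show ?thesis by simp
  qed
  have "(1 - q ^ Suc n) * (\<Sum>t\<le>Suc n. q ^ (t * (t + c)) * (r t * r (Suc n - t)) * r (t + c))
    = (1 - q ^ Suc n) * (r (Suc n) * r c) +
      (\<Sum>t\<le>n. (1 - q ^ Suc n) * (q ^ (Suc t * (Suc t + c)) * (r (Suc t) * r (n - t)) * r (Suc t + c)))"
    unfolding sum.atMost_Suc_shift distrib_left sum_distrib_left by simp
  also have "\<dots> = (?u 0 + (\<Sum>t\<le>n. if t < n then ?u (Suc t) else 0)) + (\<Sum>t\<le>n. ?v t)"
    unfolding head using tail by (simp add: sum.distrib add.assoc)
  also have "\<dots> = (\<Sum>t\<le>n. ?u t) + (\<Sum>t\<le>n. ?v t)"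
    by (subst sum_shift_if[of ?u n]) (rule refl)
  also have "\<dots> = (\<Sum>t\<le>n. q ^ (t * (t + Suc c)) * (r t * r (n - t)) * r (t + Suc c))"
    by (simp only: uv flip: sum.distrib)
  also have "\<dots> = (r (Suc n) * (1 - q ^ Suc n)) * r (n + Suc c)"
    unfolding Suc.IH r_Suc ..
  also have "\<dots> = (1 - q ^ Suc n) * (r (Suc n) * r (Suc n + c))"
    by (simp add: mult_ac)
  finally show ?case
    using one_minus_power_nonzero[of n] by (simp only: mult_cancel_left) simp
qed simp

text \<open>Apply q-Vandermonde with \<open>c = 2 * n\<close> and put s = t + n: the square is
  completed by \<open>n*n + t*(t + 2*n) = s*s\<close>. Exchanging the two summations does the
  rest.\<close>

lemma bailey_step:
  "(\<Sum>n\<le>N. q ^ (n * n) * \<alpha> n * r (N - n) * r (N + n)) =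
    (\<Sum>s\<le>N. q ^ (s * s) * r (N - s) * (\<Sum>n\<le>s. \<alpha> n * r (s - n) * r (s + n)))"
proof -
  have "q ^ (n * n) * (r (N - n) * r (N + n)) = (\<Sum>s=n..N. q ^ (s * s) * r (N - s) *
      (r (s - n) * r (s + n)))"
    if "n \<le> N" for n
  proof -
    have "r (N - n) * r (N + n) = (\<Sum>t\<le>N - n. q ^ (t * (t + 2 * n)) *
        (r t * r (N - n - t)) * r (t + 2 * n))"
      using q_vandermonde[of "2 * n" "N - n"] that by (simp add: mult_2)
    then have "q ^ (n * n) * (r (N - n) * r (N + n)) =
        q ^ (n * n) * (\<Sum>t\<le>N - n. q ^ (t * (t + 2 * n)) * (r t * r (N - n - t)) * r (t + 2 * n))"
      by simp
    also have "\<dots> = (\<Sum>t\<le>N - n. q ^ ((t + n) * (t + n)) * r (N - (t + n)) *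
        (r (t + n - n) * r (t + n + n)))"
      unfolding sum_distrib_left
          by (intro sum.cong refl) (simp add: power_add algebra_simps mult_2 mult_2_right)
    also have "\<dots> = (\<Sum>s=n..N. q ^ (s * s) * r (N - s) * (r (s - n) * r (s + n)))"
      using that
      by (intro sum.reindex_bij_witness[of _ "\<lambda>s. s - n" "\<lambda>t. t + n"]) auto
    finally show ?thesis .
  qed
  then have "(\<Sum>n\<le>N. q ^ (n * n) * \<alpha> n * r (N - n) * r (N + n)) =
      (\<Sum>n\<le>N. \<Sum>s=n..N. \<alpha> n * (q ^ (s * s) * r (N - s) * (r (s - n) * r (s + n))))"
    by (intro sum.cong refl) (simp add: mult_ac flip: sum_distrib_left)
  also have "\<dots> = (\<Sum>s\<le>N. \<Sum>n\<le>s. \<alpha> n * (q ^ (s * s) * r (N - s) * (r (s - n) * r (s + n))))"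
    unfolding sum.Sigma[of _ _, OF finite_atMost, simplified]
    by (simp add: sum.Sigma) (rule sum.reindex_bij_witness[of _ "\<lambda>(s, n). (n, s)" "\<lambda>(n, s). (s, n)"], auto)
  finally show ?thesis
    by (simp add: sum_distrib_left mult_ac)
qed

end

section \<open>The finite Jacobi triple product and the finite Rogers-Ramanujan identity\<close>

lemma choose_two_add: "(m + n) choose 2 = (m choose 2) + (n choose 2) + m * n"
proof (induction n)
  case (Suc n)
  then show ?case by (simp add: choose_two_Suc)
qed (simp add: binomial_eq_0)

lemma two_choose_two: "2 * (n choose 2) + n = n * n"
proof (induction n)
  case (Suc n)
  then show ?case by (simp add: choose_two_Suc)
qed (simp add: binomial_eq_0)

text \<open>Folds the q-binomial sum at its middle index, so that the bilateral indices n and -n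
  meet as in \<open>theta_term\<close>.\<close>

lemma sum_atMost_centered:
  fixes f :: "nat \<Rightarrow> 'a :: comm_monoid_add"
  shows "(\<Sum>m\<le>2 * N. f m) = (\<Sum>n\<le>N. if n = 0 then f N else f (N + n) + f (N - n))"
proof -
  have "(\<Sum>m\<le>2 * N. f m) = (\<Sum>m\<in>insert N ({N<..2 * N} \<union> {..<N}). f m)"
    by (rule sum.cong) auto
  also have "\<dots> = f N + ((\<Sum>m\<in>{N<..2 * N}. f m) + (\<Sum>m<N. f m))"
    by (subst sum.insert) (auto intro!: arg_cong[where f = "(+) (f N)"] sum.union_disjoint)
  also have "(\<Sum>m\<in>{N<..2 * N}. f m) = (\<Sum>n=1..N. f (N + n))"
    by (rule sum.reindex_bij_witness[of _ "\<lambda>n. N + n" "\<lambda>m. m - N"]) auto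
  also have "(\<Sum>m<N. f m) = (\<Sum>n=1..N. f (N - n))"
    by (rule sum.reindex_bij_witness[of _ "\<lambda>n. N - n" "\<lambda>m. N - m"]) auto
  also have "f N + ((\<Sum>n=1..N. f (N + n)) + (\<Sum>n=1..N. f (N - n)))
      = (\<Sum>n\<in>insert 0 {1..N}. if n = 0 then f N else f (N + n) + f (N - n))"
    by (subst sum.insert) (auto simp flip: sum.distrib)
  also have "insert 0 {1..N} = {..N}" by auto
  finally show ?thesis .
qed

text \<open>For \<open>z * w = q\<close> this collects the terms of index \<open>n\<close> and \<open>-n\<close> in the bilateral series
  \<open>\<Sum>n. (-1) ^ n * q ^ (n * (n - 1) / 2) * z ^ n\<close>.\<close>

definition theta_term :: "'a :: comm_ring_1 \<Rightarrow> 'a \<Rightarrow> 'a \<Rightarrow> nat \<Rightarrow> 'a" where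
  "theta_term q z w n = (if n = 0 then 1 else (-1) ^ n * q ^ (n choose 2) * (z ^ n + w ^ n))"

text \<open>Here \<open>w\<close> plays the role of q/z. In the lower half of the product
  \<open>q^N = z * w * q^(N-1)\<close> lets \<open>- z * q^i\<close> be factored out; in the upper
  half \<open>q^N\<close> is factored out.\<close>

lemma jacobi_product_eq:
  fixes q z w :: "'a :: comm_ring_1"
  assumes "z * w = q"
  shows "(\<Prod>i<2 * N. q ^ N + (- z) * q ^ i) =
    (- z) ^ N * q ^ ((N choose 2) + N * N) * (\<Prod>i<N. (1 - z * q ^ i) * (1 - w * q ^ i))"
proof -
  have split: "(\<Prod>i<N + N. f i) = (\<Prod>i<N. f i) * (\<Prod>i<N. f (N + i))" for f :: "nat \<Rightarrow> 'a"
    using prod.atLeastLessThan_concat[of 0 N "N + N" f] prod.shift_bounds_nat_ivl[of f 0 N N]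
    by (simp add: atLeast0LessThan add.commute)
  have q_pow: "(\<Prod>i<N. q ^ i) = q ^ (N choose 2)"
    by (induction N) (simp_all add: choose_two_Suc power_add binomial_eq_0)
  have "q ^ N + (- z) * q ^ i = (- z) * q ^ i * (1 - w * q ^ (N - Suc i))" if "i < N" for i
  proof -
    have "(z * q ^ i) * (w * q ^ (N - Suc i)) = (z * w) * q ^ (i + (N - Suc i))"
      by (simp add: power_add mult_ac)
    also have "\<dots> = q ^ Suc (i + (N - Suc i))" by (simp add: assms)
    also have "Suc (i + (N - Suc i)) = N" using that by simp
    finally show ?thesis by (simp add: algebra_simps)
  qed
  then have low: "(\<Prod>i<N. q ^ N + (- z) * q ^ i) = (- z) ^ N * q ^ (N choose 2) * (\<Prod>i<N. 1 - w * q ^ i)"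
    using prod.nat_diff_reindex[of "\<lambda>i. 1 - w * q ^ i" N]
    by (simp add: prod.distrib q_pow del: mult_minus_left add_uminus_conv_diff)
  have high: "(\<Prod>i<N. q ^ N + (- z) * q ^ (N + i)) = q ^ (N * N) * (\<Prod>i<N. 1 - z * q ^ i)"
  proof -
    have "(\<Prod>i<N. q ^ N + (- z) * q ^ (N + i)) = (\<Prod>i<N. q ^ N * (1 - z * q ^ i))"
      by (rule prod.cong) (simp_all add: algebra_simps power_add)
    then show ?thesis by (simp add: prod.distrib power_mult)
  qed
  show ?thesis
    unfolding mult_2 split low high by (simp add: prod.distrib power_add mult_ac)
qed

context q_factorial_inverse
begin

text \<open>This is the q-binomial theorem with \<open>2 * N\<close> factors, \<open>a = - z\<close>
  and \<open>b = q^N\<close>, folded at its centre. Every term and the product share a nonzero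
  factor \<open>C\<close>, which cancels.\<close>

theorem finite_jacobi_triple_product:
  assumes "z * w = q" and "q \<noteq> 0"
  shows "(\<Sum>n\<le>N. theta_term q z w n * r (N - n) * r (N + n)) =
    r (2 * N) * (\<Prod>i<N. (1 - z * q ^ i) * (1 - w * q ^ i))"
proof -
  \<comment> \<open>\<open>C\<close> is the coefficient of \<open>r N * r N\<close> in the central
    term \<open>T N\<close>.\<close>
  define C where "C = (- z) ^ N * q ^ ((N choose 2) + N * N)"
  define T where "T m = q ^ (m choose 2) * (- z) ^ m * (q ^ N) ^ (2 * N - m) *
      (r m * r (2 * N - m))" for m
  have "z \<noteq> 0" using assms by auto
  then have C: "C \<noteq> 0" using assms(2) by (simp add: C_def)
  have up: "T (N + n) = C * ((-1) ^ n * q ^ (n choose 2) * z ^ n *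
      (r (N - n) * r (N + n)))" if "n \<le> N" for n
  proof -
    have exps: "(N + n choose 2) + N * (N - n) = (N choose 2) + N * N + (n choose 2)"
    proof -
      have "N * n + N * (N - n) = N * N" using that by (simp flip: distrib_left)
      then show ?thesis by (simp add: choose_two_add)
    qed
    have "T (N + n) = q ^ ((N + n choose 2) + N * (N - n)) * (- z) ^ (N + n) * (r (N - n) * r (N + n))"
    proof -
      have "2 * N - (N + n) = N - n" using that by simp
      then show ?thesis by (simp only: T_def power_add power_mult mult_ac)
    qed
    moreover have "(- z) ^ (N + n) = (- z) ^ N * ((-1) ^ n * z ^ n)"
      unfolding power_add power_minus[of z n] ..
    ultimately show ?thesis
      unfolding exps C_def power_add by (simp only: mult_ac)
  qed
  have down: "T (N - n) = C * ((-1) ^ n * q ^ (n choose 2) * w ^ n *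
      (r (N - n) * r (N + n)))" if "n \<le> N" for n
  proof -
    define d where "d = N - n"
    then have N: "N = d + n" using that by simp
    have exps: "(N choose 2) + N * N + (n choose 2) + n = (d choose 2) + N * (N + n)"
    proof -
      have "N * n = d * n + (2 * (n choose 2) + n)" unfolding two_choose_two
          by (simp add: N distrib_right)
      moreover have "N choose 2 = (d choose 2) + (n choose 2) + d * n" by (simp add: N choose_two_add)
      ultimately show ?thesis unfolding distrib_left by linarith
    qed
    \<comment> \<open>By \<open>z * w = q\<close> the surplus \<open>q^n\<close> in the exponent
      identity becomes \<open>z^n * w^n\<close>; the power \<open>z^n\<close> then completes
      \<open>(- z)^d\<close> to \<open>(- z)^N\<close> up to sign.\<close>
    have pw: "q ^ ((d choose 2) + N * (N + n)) = q ^ ((N choose 2) + N * N + (n choose 2)) *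
        (z ^ n * w ^ n)"
      unfolding exps[symmetric] power_mult_distrib[symmetric] assms(1) power_add ..
    have "(- z) ^ n * (-1) ^ n = z ^ n"
      unfolding power_mult_distrib[symmetric] by simp
    then have zz: "(- z) ^ d * z ^ n = (- z) ^ N * (-1) ^ n"
      unfolding N power_add by (simp only: mult.assoc)
    have "N - n = d" "2 * N - d = N + n" by (simp_all add: N)
    then have "T (N - n) = q ^ ((d choose 2) + N * (N + n)) * (- z) ^ d * (r (N - n) * r (N + n))"
      by (simp only: T_def power_add power_mult mult_ac)
    also have "\<dots> = q ^ ((N choose 2) + N * N + (n choose 2)) * w ^ n * ((- z) ^ d * z ^ n) *
        (r (N - n) * r (N + n))"
      unfolding pw by (simp only: mult_ac)
    also have "\<dots> = C * ((-1) ^ n * q ^ (n choose 2) * w ^ n * (r (N - n) * r (N + n)))"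
      unfolding zz C_def power_add by (simp only: mult_ac)
    finally show ?thesis .
  qed
  have "C * (\<Sum>n\<le>N. theta_term q z w n * r (N - n) * r (N + n)) = (\<Sum>m\<le>2 * N. T m)"
    unfolding sum_atMost_centered sum_distrib_left
  proof (rule sum.cong[OF refl])
    fix n
    assume "n \<in> {..N}"
    then show "C * (theta_term q z w n * r (N - n) * r (N + n)) =
        (if n = 0 then T N else T (N + n) + T (N - n))"
      using up[of 0] up[of n] down[of n] by (cases "n =
          0") (simp_all add: theta_term_def binomial_eq_0 distrib_left distrib_right mult.assoc)
  qed
  also have "\<dots> = r (2 * N) * (\<Prod>i<2 * N. q ^ N + (- z) * q ^ i)"
    unfolding T_def by (rule q_binomial)
  also have "\<dots> = C * (r (2 * N) * (\<Prod>i<N. (1 - z * q ^ i) * (1 - w * q ^ i)))"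
    unfolding jacobi_product_eq[OF assms(1)] C_def by (simp add: mult_ac)
  finally show ?thesis using C by (simp only: mult_cancel_left) simp
qed

text \<open>Iterating the Bailey step twice multiplies the \<open>n\<close>-th term by \<open>q ^ (2 * n * n)\<close>; started at
  \<open>z = q\<close>, \<open>w = 1\<close>, where the triple product vanishes, it produces the Rogers--Ramanujan theta series.\<close>

theorem finite_rogers_ramanujan:
  assumes "q \<noteq> 0"
  shows "(\<Sum>s\<le>N. q ^ (s * s) * r s * r (N - s)) =
    (\<Sum>n\<le>N. theta_term (q ^ 5) (q ^ 3) (q ^ 2) n * r (N - n) * r (N + n))"
proof -
  \<comment> \<open>With \<open>w = 1\<close> the factor of index 0 in the triple product is zero;
    only the empty product at s = 0 survives.\<close>
  have delta: "(\<Sum>n\<le>s. theta_term q q 1 n * r (s - n) * r (s + n)) = (if s = 0 then 1 else 0)" for s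
  proof (cases s)
    case 0
    then show ?thesis by (simp add: theta_term_def)
  next
    case (Suc t)
    have "(\<Prod>i<s. (1 - q * q ^ i) * (1 - 1 * q ^ i)) = 0"
      by (rule prod_zero[OF _ bexI[of _ 0]]) (simp_all add: Suc)
    then show ?thesis
      unfolding finite_jacobi_triple_product[OF mult_1_right assms] using Suc by simp
  qed
  have first: "(\<Sum>n\<le>s. (q ^ (n * n) * theta_term q q 1 n) * r (s - n) * r (s + n)) = r s" for s
  proof -
    have "(\<Sum>n\<le>s. q ^ (n * n) * theta_term q q 1 n * r (s - n) * r (s + n))
        = (\<Sum>n\<le>s. if n = 0 then r s else 0)"
      unfolding bailey_step[of "theta_term q q 1"] delta by (rule sum.cong) auto
    then show ?thesis by simp
  qed
  \<comment> \<open>With c = n choose 2, the relation \<open>2*c + n = n*n\<close> gives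
    \<open>5*c + 2*n = c + 2*n*n\<close>, and likewise with one more n on both sides.\<close>
  have twice: "theta_term (q ^ 5) (q ^ 3) (q ^ 2) n =
      q ^ (n * n) * (q ^ (n * n) * theta_term q q 1 n)" for n
  proof (cases "n = 0")
    case False
    let ?c = "n choose 2"
    have "(q ^ 5) ^ ?c = q ^ (4 * ?c) * q ^ ?c"
      unfolding power_mult[symmetric] power_add[symmetric] by (rule arg_cong[where f = "power q"]) simp
    moreover have "(q ^ 3) ^ n + (q ^ 2) ^ n = q ^ (2 * n) * (q ^ n + 1 ^ n)"
      unfolding distrib_left power_one mult_1_right power_mult[symmetric] power_add[symmetric]
      by (simp add: numeral_3_eq_3)
    ultimately have "theta_term (q ^ 5) (q ^ 3) (q ^ 2) n
        = (-1) ^ n * (q ^ (4 * ?c) * q ^ ?c) * (q ^ (2 * n) * (q ^ n + 1 ^ n))"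
      using False by (simp only: theta_term_def if_False)
    also have "\<dots> = (q ^ (4 * ?c) * q ^ (2 * n)) * theta_term q q 1 n"
      using False by (simp only: theta_term_def if_False mult_ac)
    also have "q ^ (4 * ?c) * q ^ (2 * n) = q ^ (n * n) * q ^ (n * n)"
      unfolding power_add[symmetric] using two_choose_two[of n]
      by (intro arg_cong[where f = "power q"]) linarith
    finally show ?thesis by (simp only: mult.assoc)
  qed (simp add: theta_term_def)
  show ?thesis
    unfolding twice bailey_step[of "\<lambda>n. q ^ (n * n) * theta_term q q 1 n" N] first
    by (rule sum.cong[OF refl]) (simp only: mult_ac)
qed

end

subsection \<open>Generating functions and the Rogers--Ramanujan identity\<close>

text \<open>Congruence modulo \<open>fps_X ^ K\<close>. It lets sufficiently long finite sums and
  products stand for infinite ones.\<close>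

definition agree :: "nat \<Rightarrow> 'a :: comm_ring_1 fps \<Rightarrow> 'a fps \<Rightarrow> bool" where
  "agree K f g \<longleftrightarrow> (\<forall>i<K. fps_nth f i = fps_nth g i)"

lemma agree_refl [simp]: "agree K f f"
  by (simp add: agree_def)

lemma agree_sym: "agree K f g \<Longrightarrow> agree K g f"
  by (simp add: agree_def)

lemma agree_trans [trans]: "agree K f g \<Longrightarrow> agree K g h \<Longrightarrow> agree K f h"
  by (simp add: agree_def)

lemma agree_mult: "agree K f f' \<Longrightarrow> agree K g g' \<Longrightarrow> agree K (f * g) (f' * g')"
  by (auto simp: agree_def fps_mult_nth intro!: sum.cong)

lemma agree_sum: "(\<And>i. i \<in> I \<Longrightarrow> agree K (f i) (g i)) \<Longrightarrow> agree K (sum f I) (sum g I)"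
  by (simp add: agree_def fps_sum_nth)

lemma agree_fps_X_power: "K \<le> e \<Longrightarrow> agree K (fps_X ^ e) 0"
  by (simp add: agree_def)

section \<open>Generating functions of multisets of parts\<close>

definition mset_parts :: "nat set \<Rightarrow> nat \<Rightarrow> nat multiset set" where
  "mset_parts A n = {\<nu>. set_mset \<nu> \<subseteq> A \<and> sum_mset \<nu> = n}"

lemma sum_mset_member_le: "x \<in># \<nu> \<Longrightarrow> x \<le> sum_mset (\<nu> :: nat multiset)"
  by (induction \<nu>) auto

lemma finite_mset_parts:
  assumes "0 \<notin> A"
  shows "finite (mset_parts A n)"
proof (rule finite_subset)
  have "size \<nu> \<le> sum_mset \<nu>" if "0 \<notin># \<nu>" for \<nu> :: "nat multiset"
    using that by (induction \<nu>) auto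
  with assms show "mset_parts A n \<subseteq> {\<nu>. set_mset \<nu> \<subseteq> {..n} \<and> size \<nu> \<le> n}"
    by (force simp: mset_parts_def dest: sum_mset_member_le)
  have "{\<nu>. set_mset \<nu> \<subseteq> {..n} \<and> size \<nu> \<le> n} \<subseteq> mset ` {xs. set xs \<subseteq> {..n} \<and> length xs \<le> n}"
    by (auto simp: image_iff) (metis ex_mset mem_Collect_eq set_mset_mset size_mset)
  then show "finite {\<nu>. set_mset \<nu> \<subseteq> {..n} \<and> size \<nu> \<le> n}"
    by (rule finite_subset) (simp add: finite_lists_length_le)
qed

definition parts_fps :: "nat set \<Rightarrow> int fps" where
  "parts_fps A = Abs_fps (\<lambda>n. int (card (mset_parts A n)))"

lemma parts_fps_nth [simp]: "fps_nth (parts_fps A) n = int (card (mset_parts A n))"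
  by (simp add: parts_fps_def)

lemma parts_fps_empty [simp]: "parts_fps {} = 1"
proof (rule fps_ext)
  fix n
  have "mset_parts {} n = (if n = 0 then {{#}} else {})"
    by (auto simp: mset_parts_def)
  then show "fps_nth (parts_fps {}) n = fps_nth 1 n" by simp
qed

text \<open>Removing one copy of \<open>a\<close> maps the multisets containing \<open>a\<close>
  bijectively onto all multisets of sum \<open>n - a\<close>, so the factor \<open>1 - X^a\<close>
  subtracts exactly the former.\<close>

lemma parts_fps_insert:
  assumes "0 \<notin> insert a A" and "a \<notin> A"
  shows "parts_fps (insert a A) * (1 - fps_X ^ a) = parts_fps A"
proof (rule fps_ext)
  fix n
  let ?B = "{\<nu> \<in> mset_parts (insert a A) n. a \<in># \<nu>}"
  have B: "card ?B = (if n < a then 0 else card (mset_parts (insert a A) (n - a)))"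
  proof (cases "n < a")
    case True
    then have "?B = {}" by (auto simp: mset_parts_def dest: sum_mset_member_le)
    then show ?thesis using True by (simp del: Collect_empty_eq)
  next
    case False
    then have "bij_betw (add_mset a) (mset_parts (insert a A) (n - a)) ?B"
      by (intro bij_betw_byWitness[where f' = "\<lambda>\<nu>. \<nu> - {#a#}"])
        (auto simp: mset_parts_def sum_mset_diff dest: in_diffD)
    with False show ?thesis by (simp add: bij_betw_same_card)
  qed
  have "mset_parts (insert a A) n = mset_parts A n \<union> ?B"
    using assms(2) by (auto simp: mset_parts_def)
  moreover have "mset_parts A n \<inter> ?B = {}"
    using assms(2) by (auto simp: mset_parts_def)
  ultimately have "card (mset_parts (insert a A) n) = card (mset_parts A n) + card ?B"
    using finite_mset_parts[of "insert a A" n] assms(1)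
    by (metis card_Un_disjoint finite_Un)
  then show "fps_nth (parts_fps (insert a A) * (1 - fps_X ^ a)) n = fps_nth (parts_fps A) n"
    unfolding B by (simp add: right_diff_distrib fps_X_power_mult_right_nth)
qed

text \<open>The denominators are multiplied out, and \<open>A\<close> may be infinite: the form
  serves both finite q-factorials and the full set of parts 1 or 4 modulo 5.\<close>

lemma parts_fps_Un:
  assumes "finite B" and "0 \<notin> A \<union> B" and "A \<inter> B = {}"
  shows "parts_fps (A \<union> B) * (\<Prod>b\<in>B. 1 - fps_X ^ b) = parts_fps A"
  using assms
proof (induction B)
  case (insert b B)
  have "parts_fps (A \<union> insert b B) * (\<Prod>b\<in>insert b B. 1 - fps_X ^ b)
    = (parts_fps (insert b (A \<union> B)) * (1 - fps_X ^ b)) * (\<Prod>b\<in>B. 1 - fps_X ^ b)"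
    using insert.hyps by (simp add: mult_ac)
  then show ?case using insert parts_fps_insert[of b "A \<union> B"] by (simp flip: mult.assoc)
qed simp

text \<open>Taking away the prescribed copies of \<open>a\<close> and \<open>b\<close>, of weight
  \<open>i * a + l * b\<close>, leaves an arbitrary multiset over \<open>A - {a, b}\<close>; its
  series arises from that of \<open>A\<close> by two factors.\<close>

lemma card_mset_parts_two_counts:
  assumes "0 \<notin> A" and "a \<in> A" and "b \<in> A" and "a \<noteq> b"
  shows "int (card {\<nu> \<in> mset_parts A n. count \<nu> a = i \<and> count \<nu> b = l}) =
    fps_nth (fps_X ^ (i * a + l * b) * ((1 - fps_X ^ a) * (1 - fps_X ^ b) * parts_fps A)) n"
proof -
  let ?L = "{\<nu> \<in> mset_parts A n. count \<nu> a = i \<and> count \<nu> b = l}"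
  let ?w = "replicate_mset i a + replicate_mset l b"
  have w: "sum_mset ?w = i * a + l * b"
    by simp
  have "card ?L =
      (if n < i * a + l * b then 0 else card (mset_parts (A - {a, b}) (n - (i * a + l * b))))"
  proof (cases "n < i * a + l * b")
    case True
    have "False" if "\<nu> \<in> ?L" for \<nu>
    proof -
      have "?w \<subseteq># \<nu>" using that assms(4) by (auto simp: subseteq_mset_def)
      then have "sum_mset ?w \<le> sum_mset \<nu>" by (metis le_add1 subset_mset.add_diff_inverse sum_mset.union)
      with that True w show False by (simp add: mset_parts_def)
    qed
    then have "?L = {}" by blast
    then show ?thesis using True by (simp del: Collect_empty_eq)
  next
    case False
    have "?w \<subseteq># \<nu>" if "\<nu> \<in> ?L" for \<nu>
      using that assms(4) by (auto simp: subseteq_mset_def)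
    then have "bij_betw (\<lambda>\<nu>. \<nu> + ?w) (mset_parts (A - {a, b}) (n - (i * a + l * b))) ?L"
      using False assms
      by (intro bij_betw_byWitness[where f' = "\<lambda>\<nu>. \<nu> - ?w"])
        (auto simp: mset_parts_def sum_mset_diff subset_mset.diff_add in_diff_count not_in_iff split: if_splits)
    with False show ?thesis by (simp add: bij_betw_same_card)
  qed
  moreover have "(1 - fps_X ^ a) * (1 - fps_X ^ b) * parts_fps A = parts_fps (A - {a, b})"
  proof -
    have "A - {a, b} \<union> {a, b} = A" using assms by blast
    then show ?thesis
      using parts_fps_Un[of "{a, b}" "A - {a, b}"] assms by (simp add: mult.commute)
  qed
  ultimately show ?thesis
    by (simp add: fps_X_power_mult_nth)
qed

text \<open>Parts d, 2d, ..., nd are counted by the inverse of (1 - X^d) ... (1 - X^(nd)). The bases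
  d = 1 and d = 5 both occur below.\<close>

lemma q_factorial_inverse_parts_fps:
  assumes "d > 0"
  shows "q_factorial_inverse (fps_X ^ d) (\<lambda>n. parts_fps ((*) d ` {1..n}))"
proof
  fix n
  have "(*) d ` {1..Suc n} = insert (d * Suc n) ((*) d ` {1..n})"
    by (simp add: atLeastAtMostSuc_conv)
  moreover have "0 \<notin> (*) d ` {1..n}"
    using assms by auto
  moreover have "d * Suc n \<notin> (*) d ` {1..n}"
    using assms by (auto simp del: mult_Suc_right)
  ultimately show "parts_fps ((*) d ` {1..Suc n}) * (1 - (fps_X ^ d) ^ Suc n) =
      parts_fps ((*) d ` {1..n})"
    using parts_fps_insert[of "d * Suc n" "(*) d ` {1..n}"] assms
        by (auto simp flip: power_mult simp del: mult_Suc_right power_Suc)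
qed simp

section \<open>Passage to the limit in the Rogers-Ramanujan identity\<close>

lemma agree_parts_fps:
  assumes "\<And>i. i < K \<Longrightarrow> i \<in> A \<longleftrightarrow> i \<in> B"
  shows "agree K (parts_fps A) (parts_fps B)"
proof -
  have "mset_parts A n = mset_parts B n" if "n < K" for n
    using assms that unfolding mset_parts_def
    by (auto dest: sum_mset_member_le) (meson le_less_trans subsetD sum_mset_member_le)+
  then show ?thesis by (simp add: agree_def)
qed

lemma agree_fps_X_power_mult: "K \<le> e \<Longrightarrow> agree K (fps_X ^ e * f) 0"
  using agree_mult[OF agree_fps_X_power agree_refl] by (metis mult_zero_left)

lemma agree_theta_term:
  assumes "K \<le> n"
  shows "agree K (theta_term (fps_X ^ 5) (fps_X ^ 3) (fps_X ^ 2) n :: int fps) 0"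
proof (cases "n = 0")
  case False
  let ?q = "fps_X :: int fps"
  have "(?q ^ 3) ^ n = ?q ^ n * (?q ^ 2) ^ n" "(?q ^ 2) ^ n = ?q ^ n * ?q ^ n"
    by (simp_all add: power3_eq_cube power2_eq_square power_mult_distrib mult.assoc)
  then have "(?q ^ 3) ^ n + (?q ^ 2) ^ n = ?q ^ n * ((?q ^ 2) ^ n + ?q ^ n)"
    by (simp add: distrib_left)
  then have "theta_term (?q ^ 5) (?q ^ 3) (?q ^ 2) n =
      ?q ^ n * ((-1) ^ n * (?q ^ 5) ^ (n choose 2) * ((?q ^ 2) ^ n + ?q ^ n))"
    using False by (simp only: theta_term_def if_False mult_ac)
  then show ?thesis
    by (simp only: agree_fps_X_power_mult[OF assms])
qed (use assms in \<open>simp add: agree_def\<close>)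

text \<open>The cut-off \<open>2 * K\<close> leaves two cases: for n up to \<open>K\<close> both
  indices are at least \<open>K\<close>, where \<open>\<rho>\<close> is stable; for larger n the
  theta term vanishes modulo \<open>X^K\<close>.\<close>

lemma agree_theta_sum:
  fixes \<rho> :: "nat \<Rightarrow> int fps"
  assumes "\<And>m. K \<le> m \<Longrightarrow> agree K (\<rho> m) \<sigma>"
  shows "agree K (\<Sum>n\<le>2 * K. theta_term (fps_X ^ 5) (fps_X ^ 3) (fps_X ^ 2) n * \<rho> (2 * K - n) * \<rho> (2 * K + n))
    ((\<Sum>n\<le>2 * K. theta_term (fps_X ^ 5) (fps_X ^ 3) (fps_X ^ 2) n) * (\<sigma> * \<sigma>))"
  unfolding sum_distrib_right
proof (rule agree_sum)
  fix n
  let ?t = "theta_term (fps_X ^ 5) (fps_X ^ 3) (fps_X ^ 2) n :: int fps"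
  show "agree K (?t * \<rho> (2 * K - n) * \<rho> (2 * K + n)) (?t * (\<sigma> * \<sigma>))"
  proof (cases "n \<le> K")
    case True
    then have "agree K (\<rho> (2 * K - n)) \<sigma>" "agree K (\<rho> (2 * K + n)) \<sigma>"
      by (simp_all add: assms)
    then show ?thesis
      unfolding mult.assoc by (intro agree_mult agree_refl)
  next
    case False
    then have t: "agree K ?t 0" by (simp add: agree_theta_term)
    have "agree K (?t * (\<rho> (2 * K - n) * \<rho> (2 * K + n))) (0 * (\<rho> (2 * K - n) * \<rho> (2 * K + n)))"
      by (intro agree_mult t agree_refl)
    also have "agree K (0 * (\<rho> (2 * K - n) * \<rho> (2 * K + n))) (0 * (\<sigma> * \<sigma>))"
      by simp
    also have "agree K (0 * (\<sigma> * \<sigma>)) (?t * (\<sigma> * \<sigma>))"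
      by (intro agree_mult agree_sym[OF t] agree_refl)
    finally show ?thesis by (simp only: mult.assoc)
  qed
qed

lemma parts_fps_mod_5:
  "parts_fps {1..5 * N} * (\<Prod>i<N. (1 - fps_X ^ (5 * i + 2)) * ((1 - fps_X ^ (5 * i + 3)) *
      (1 - fps_X ^ (5 * i + 5))))
    = parts_fps {i \<in> {1..5 * N}. i mod 5 = 1 \<or> i mod 5 = 4}"
proof -
  let ?A = "{i \<in> {1..5 * N}. i mod 5 = 1 \<or> i mod 5 = 4}"
  let ?B = "\<Union>i<N. {5 * i + 2, 5 * i + 3, 5 * i + 5}"
  \<comment> \<open>Subtracting 1 first puts \<open>5 * i + 5\<close> into block i instead of the
    next one.\<close>
  have idx: "(x - 1) div 5 = i" if "x \<in> {5 * i + 2, 5 * i + 3, 5 * i + 5}" for x i :: nat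
    using that by (elim insertE emptyE) simp_all
  have AB: "?A \<union> ?B = {1..5 * N}"
  proof (intro equalityI subsetI)
    fix x
    assume x: "x \<in> {1..5 * N}"
    define i where "i = (x - 1) div 5"
    have "x = 5 * i + ((x - 1) mod 5 + 1)" "(x - 1) mod 5 < 5"
      using x by (simp_all add: i_def)
    then have "x = 5 * i + 1 \<or> x = 5 * i + 2 \<or> x = 5 * i + 3 \<or> x = 5 * i + 4 \<or> x = 5 * i + 5"
      by linarith
    moreover from this have "i < N" using x by (simp only: atLeastAtMost_iff) linarith
    ultimately show "x \<in> ?A \<union> ?B" using x
      by (elim disjE) (simp_all, blast+)
  next
    fix x
    assume "x \<in> ?A \<union> ?B"
    then show "x \<in> {1..5 * N}" by (elim UnE UN_E insertE emptyE) simp_all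
  qed
  have "(5 * i + 2) mod 5 = 2" "(5 * i + 3) mod 5 = 3" "(5 * i + 5) mod 5 = 0" for i :: nat
    by presburger+
  then have "x mod 5 \<in> {0, 2, 3}" if "x \<in> ?B" for x
    using that by (elim UN_E insertE emptyE) (simp_all only: insert_iff simp_thms)
  then have "?A \<inter> ?B = {}" by fastforce
  then have "parts_fps {1..5 * N} * (\<Prod>b\<in>?B. 1 - fps_X ^ b) = parts_fps ?A"
    using parts_fps_Un[of ?B ?A] unfolding AB by simp
  also have "(\<Prod>b\<in>?B. 1 - fps_X ^ b :: int fps) =
      (\<Prod>i<N. \<Prod>b\<in>{5 * i + 2, 5 * i + 3, 5 * i + 5}. 1 - fps_X ^ b)"
  proof (rule prod.UNION_disjoint)
    show "\<forall>i\<in>{..<N}. \<forall>j\<in>{..<N}. i \<noteq> j \<longrightarrow>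
        {5 * i + 2, 5 * i + 3, 5 * i + 5} \<inter> {5 * j + 2, 5 * j + 3, 5 * j + 5} = {}"
    proof (intro ballI impI equals0I)
      fix i j x :: nat
      assume "i \<noteq> j" and "x \<in> {5 * i + 2, 5 * i + 3, 5 * i + 5} \<inter> {5 * j + 2, 5 * j + 3, 5 * j + 5}"
      then show False using idx[of x i] idx[of x j] by (simp only: Int_iff)
    qed
  qed simp_all
  finally show ?thesis by (simp add: mult.assoc)
qed

text \<open>Both sides are compared with the theta sum \<open>\<Theta>\<close>. The finite identity
  in base \<open>q\<close> gives \<open>\<Theta> * r N\<close> for the sum side; the triple product
  in base \<open>q ^ 5\<close> evaluates \<open>\<Theta>\<close> as a product, which cancels from
  \<open>r (5 * N)\<close> all parts other than 1 and 4 modulo 5.\<close>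

theorem rogers_ramanujan:
  "agree K (\<Sum>s\<le>2 * K. fps_X ^ (s * s) * parts_fps {1..s}) (parts_fps {i. i mod 5 = 1 \<or> i mod 5 = 4})"
proof -
  \<comment> \<open>For s up to \<open>K\<close> the index \<open>N - s\<close> is still at least
    \<open>K\<close>, where \<open>r\<close> no longer changes modulo \<open>X^K\<close>.\<close>
  define N where "N = 2 * K"
  define q :: "int fps" where "q = fps_X"
  define r where "r n = parts_fps {1..n}" for n
  define R where "R n = parts_fps ((*) 5 ` {1..n})" for n
  define \<Theta> where "\<Theta> = (\<Sum>n\<le>N. theta_term (q ^ 5) (q ^ 3) (q ^ 2) n)"
  define G where "G = (\<Sum>s\<le>N. q ^ (s * s) * r s)"
  interpret r: q_factorial_inverse q r
    using q_factorial_inverse_parts_fps[of 1] by (simp add: q_def r_def[abs_def])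
  interpret R: q_factorial_inverse "q ^ 5" R
    using q_factorial_inverse_parts_fps[of 5] by (simp add: q_def R_def[abs_def])
  let ?P = "\<Prod>i<N. (1 - q ^ 3 * (q ^ 5) ^ i) * (1 - q ^ 2 * (q ^ 5) ^ i)"
  \<comment> \<open>These q-factorials invert \<open>r N\<close> and \<open>R N\<close>, so common
    factors cancel without division.\<close>
  let ?e = "\<lambda>q. \<Prod>i<N. 1 - q ^ Suc i"
  have r_lim: "agree K (r m) (r m')" if "K \<le> m" "K \<le> m'" for m m'
    using that unfolding r_def by (intro agree_parts_fps) auto
  have R_lim: "agree K (R m) (R m')" if "K \<le> m" "K \<le> m'" for m m'
    using that unfolding R_def by (intro agree_parts_fps) auto
  have KN: "K \<le> N" by (simp add: N_def)
  have "agree K (G * r N) (\<Sum>s\<le>N. q ^ (s * s) * r s * r (N - s))"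
    unfolding G_def sum_distrib_right
  proof (rule agree_sum)
    fix s
    show "agree K (q ^ (s * s) * r s * r N) (q ^ (s * s) * r s * r (N - s))"
    proof (cases "s \<le> K")
      case True
      then have "K \<le> N - s" by (simp add: N_def)
      then show ?thesis by (intro agree_mult agree_refl r_lim KN)
    next
      case False
      then have "K \<le> s * s" using le_square[of s] by linarith
      then show ?thesis
        unfolding q_def mult.assoc by (metis agree_fps_X_power_mult agree_sym agree_trans)
    qed
  qed
  also have "(\<Sum>s\<le>N. q ^ (s * s) * r s * r (N - s)) =
      (\<Sum>n\<le>N. theta_term (q ^ 5) (q ^ 3) (q ^ 2) n * r (N - n) * r (N + n))"
    by (rule r.finite_rogers_ramanujan) (simp add: q_def)
  also have "agree K \<dots> (\<Theta> * (r N * r N))"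
    unfolding \<Theta>_def q_def N_def by (rule agree_theta_sum) (use r_lim KN N_def in simp)
  finally have "agree K (G * r N * ?e q) (\<Theta> * (r N * r N) * ?e q)"
    by (rule agree_mult[OF _ agree_refl])
  then have G: "agree K G (\<Theta> * r N)"
    using r.r_mult_prod[of N] by (simp add: mult.assoc)
  have "(\<Sum>n\<le>N. theta_term (q ^ 5) (q ^ 3) (q ^ 2) n * R (N - n) * R (N + n)) = R (2 * N) * ?P"
    by (rule R.finite_jacobi_triple_product) (simp_all add: q_def flip: power_add)
  moreover have "agree K (\<Sum>n\<le>N. theta_term (q ^ 5) (q ^ 3) (q ^ 2) n * R (N - n) * R (N + n)) (\<Theta> *
      (R N * R N))"
    unfolding \<Theta>_def q_def N_def by (rule agree_theta_sum) (use R_lim KN N_def in simp)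
  ultimately have "agree K (\<Theta> * (R N * R N)) (R (2 * N) * ?P)"
    using agree_sym by simp
  also have "agree K (R (2 * N) * ?P) (R N * ?P)"
    using KN by (intro agree_mult agree_refl R_lim) simp_all
  finally have RR: "agree K (\<Theta> * (R N * R N) * (?e (q ^ 5) * ?e (q ^ 5))) (R N * ?P *
      (?e (q ^ 5) * ?e (q ^ 5)))"
    by (rule agree_mult[OF _ agree_refl])
  have e1: "\<Theta> * (R N * R N) * (?e (q ^ 5) * ?e (q ^ 5)) = \<Theta> * (R N * ?e (q ^ 5)) * (R N * ?e (q ^ 5))"
    by (simp only: mult_ac)
  have e2: "R N * ?P * (?e (q ^ 5) * ?e (q ^ 5)) = R N * ?e (q ^ 5) * (?P * ?e (q ^ 5))"
    by (simp only: mult_ac)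
  have "agree K \<Theta> (?P * ?e (q ^ 5))"
    using RR unfolding e1 e2 R.r_mult_prod mult_1_left mult_1_right .
  then have \<Theta>: "agree K (\<Theta> * r N) (?P * ?e (q ^ 5) * r (5 * N))"
    using KN by (intro agree_mult r_lim) simp_all
  note G
  also note \<Theta>
  also have "?P * ?e (q ^ 5) * r (5 * N) = parts_fps {i \<in> {1..5 * N}. i mod 5 = 1 \<or> i mod 5 = 4}"
  proof -
    have "q ^ 3 * (q ^ 5) ^ i = q ^ (5 * i + 3)" "q ^ 2 * (q ^ 5) ^ i = q ^ (5 * i + 2)"
      "(q ^ 5) ^ Suc i = q ^ (5 * i + 5)" for i
      unfolding power_add power_mult by (simp_all only: power_Suc mult.commute)
    then have "?P * ?e (q ^ 5) = (\<Prod>i<N. (1 - q ^ (5 * i + 2)) * ((1 - q ^ (5 * i + 3)) *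
        (1 - q ^ (5 * i + 5))))"
      unfolding prod.distrib[symmetric]
      by (intro prod.cong refl) (simp only: mult_ac)
    then show ?thesis using parts_fps_mod_5[of N] by (simp add: r_def q_def mult_ac)
  qed
  also have "agree K \<dots> (parts_fps {i. i mod 5 = 1 \<or> i mod 5 = 4})"
  proof (rule agree_parts_fps)
    fix i
    assume "i < K"
    moreover have "i mod 5 = 1 \<or> i mod 5 = 4 \<Longrightarrow> i \<noteq> 0" by auto
    ultimately show "i \<in> {i \<in> {1..5 * N}. i mod 5 = 1 \<or> i mod 5 = 4} \<longleftrightarrow> i \<in> {i. i mod 5 =
        1 \<or> i mod 5 = 4}"
      by (auto simp: N_def)
  qed
  finally show ?thesis by (simp add: G_def q_def r_def N_def)
qed

subsection \<open>The column bijection\<close>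

text \<open>In a weakly decreasing list the entries above \<open>i\<close> form an initial segment.
  The resulting criterion for a cell of the diagram is what makes conjugation an involution.\<close>

lemma less_length_filter_iff:
  fixes ys :: "nat list"
  assumes "sorted_wrt (\<ge>) ys"
  shows "c < length (filter (\<lambda>x. i < x) ys) \<longleftrightarrow> c < length ys \<and> i < ys ! c"
  using assms
proof (induction ys arbitrary: c)
  case (Cons y ys)
  show ?case
  proof (cases "i < y")
    case True
    then show ?thesis using Cons by (cases c) auto
  next
    case False
    then have "filter (\<lambda>x. i < x) (y # ys) = []"
      using Cons.prems by (force simp: filter_empty_conv)
    moreover have "\<not> i < (y # ys) ! c" if "c < length (y # ys)"
      using nth_mem[OF that] False Cons.prems by auto
    ultimately show ?thesis by auto
  qed
qed simp

lemma length_filter_map_upt: "length (filter P (map f [0..<n])) = card {i. i < n \<and> P (f i)}"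
  unfolding length_filter_conv_card by (rule arg_cong[where f = card]) auto

lemma length_filter_antimono:
  fixes ys :: "nat list"
  assumes "i \<le> j"
  shows "length (filter (\<lambda>x. j < x) ys) \<le> length (filter (\<lambda>x. i < x) ys)"
  using assms by (induction ys) auto

lemma sorted_wrt_ge_column_lengths:
  fixes ys :: "nat list"
  shows "sorted_wrt (\<ge>) (map (\<lambda>c. length (filter (\<lambda>x. c < x) ys)) [0..<n])"
  by (auto simp: sorted_wrt_iff_nth_less intro!: length_filter_antimono)

lemma card_less_less: "b \<le> n \<Longrightarrow> card {i. i < n \<and> i < b} = (b :: nat)"
proof -
  assume "b \<le> n"
  then have "{i. i < n \<and> i < b} = {..<b}" by auto
  then show ?thesis by simp
qed

context
  fixes xs :: "nat list"
  assumes sorted: "sorted_wrt (\<ge>) xs"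
begin

lemma sorted_conjugate: "sorted_wrt (\<ge>) (conjugate xs)"
  unfolding conjugate_def by (rule sorted_wrt_ge_column_lengths)

lemma set_conjugate: "set (conjugate xs) \<subseteq> {1..length xs}"
proof -
  have "0 < length (filter (\<lambda>x. c < x) xs)" if "c < Max (insert 0 (set xs))" for c
  proof -
    from that have "\<exists>x\<in>set xs. c < x" by (subst (asm) Max_gr_iff) auto
    then show ?thesis by (auto simp: filter_empty_conv)
  qed
  then show ?thesis
    by (auto simp: conjugate_def Suc_le_eq length_filter_le simp del: length_greater_0_conv)
qed

text \<open>Since \<open>conjugate\<close> forgets zero rows, the way back must be told the number
  of rows and so restores them.\<close>

lemma column_lengths_conjugate:
  "map (\<lambda>i. length (filter (\<lambda>x. i < x) (conjugate xs))) [0..<length xs] = xs"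
proof (rule nth_equalityI)
  fix i
  assume "i < length (map (\<lambda>i. length (filter (\<lambda>x. i < x) (conjugate xs))) [0..<length xs])"
  then have i: "i < length xs" by simp
  then have "xs ! i \<le> Max (insert 0 (set xs))" by (intro Max_ge) auto
  then have "length (filter (\<lambda>x. i < x) (conjugate xs)) = xs ! i"
    unfolding conjugate_def length_filter_map_upt
    using i by (simp add: less_length_filter_iff[OF sorted] card_less_less)
  with i show "map (\<lambda>i. length (filter (\<lambda>x. i < x) (conjugate xs))) [0..<length xs] ! i = xs ! i"
    by simp
qed simp

text \<open>Entries at most \<open>m\<close> need at most \<open>m\<close> rows, the longest of
  which has length \<open>length xs\<close>; the rest is the criterion for cells again.\<close>

lemma conjugate_column_lengths:
  assumes "set xs \<subseteq> {1..m}"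
  shows "conjugate (map (\<lambda>i. length (filter (\<lambda>x. i < x) xs)) [0..<m]) = xs" (is "conjugate ?r = _")
proof -
  have "Max (insert 0 (set ?r)) = length xs"
  proof (rule Max_eqI)
    have "length xs = 0 \<or> 0 < m" using assms by (cases xs) auto
    moreover have "length (filter (\<lambda>x. 0 < x) xs) = length xs"
      using assms by (subst filter_True) auto
    ultimately show "length xs \<in> insert 0 (set ?r)" by force
  qed auto
  then have "conjugate ?r = map (\<lambda>c. length (filter (\<lambda>x. c < x) ?r)) [0..<length xs]"
    by (simp add: conjugate_def)
  also have "\<dots> = map (\<lambda>c. xs ! c) [0..<length xs]"
  proof (rule map_cong[OF refl])
    fix c
    assume "c \<in> set [0..<length xs]"
    then have c: "c < length xs" by simp
    with assms have "xs ! c \<le> m" using nth_mem by fastforce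
    with c show "length (filter (\<lambda>x. c < x) ?r) = xs ! c"
      unfolding length_filter_map_upt by (simp add: less_length_filter_iff[OF sorted] card_less_less)
  qed
  also have "\<dots> = xs" by (rule map_nth)
  finally show ?thesis .
qed

end

lemma sum_list_conjugate: "sum_list (conjugate xs) = sum_list xs"
proof -
  let ?L = "Max (insert 0 (set xs))"
  \<comment> \<open>Cells are counted by columns and by rows. The bound \<open>L\<close> is
    arbitrary because the maximum varies with the list in the induction.\<close>
  have "(\<Sum>c<L. length (filter (\<lambda>x. c < x) ys)) =
      sum_list ys" if "\<forall>y\<in>set ys. y \<le> L" for L and ys :: "nat list"
    using that
  proof (induction ys)
    case (Cons y ys)
    have "(\<Sum>c<L. length (filter (\<lambda>x. c < x) (y # ys))) =
        (\<Sum>c<L. (if c < y then 1 else 0) + length (filter (\<lambda>x. c < x) ys))"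
      by (rule sum.cong) auto
    also have "\<dots> = card {c. c < L \<and> c < y} + sum_list ys"
      using Cons by (simp add: sum.distrib sum.If_cases Collect_conj_eq lessThan_def)
    finally show ?case using Cons.prems by (simp add: card_less_less)
  qed simp
  then have "(\<Sum>c<?L. length (filter (\<lambda>x. c < x) xs)) = sum_list xs"
    by (simp add: Max_ge)
  then show ?thesis
    by (simp add: conjugate_def interv_sum_list_conv_sum_set_nat atLeast0LessThan)
qed

text \<open>Weight of the staircase 2m - 1, ..., 3, 1 that \<open>col\<close> removes, the source of
  the exponent m^2.\<close>

lemma sum_odd_descending: "(\<Sum>i<m. 2 * (m - i) - 1) = m * (m :: nat)"
proof (induction m)
  case (Suc m)
  have "(\<Sum>i<Suc m. 2 * (Suc m - i) - 1) = (2 * Suc m - 1) + (\<Sum>i<m. 2 * (m - i) - 1)"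
    by (subst sum.lessThan_Suc_shift) simp
  then show ?case using Suc by simp
qed simp

text \<open>Subtracting the staircase turns gaps of at least two into weak descent, and conjugating
  \<open>m\<close> rows, some possibly zero, gives parts at most \<open>m\<close>. Conversely the
  column lengths form \<open>m\<close> rows to which the staircase is added again.\<close>

lemma bij_betw_col:
  "bij_betw col {xs \<in> Diff2. length xs = m \<and> sum_list xs = N}
     {ys. sorted_wrt (\<ge>) ys \<and> set ys \<subseteq> {1..m} \<and> sum_list ys + m * m = N}"
proof -
  define d where "d i = 2 * (m - i) - 1" for i
  define shift where "shift r = map (\<lambda>i. r ! i + d i) [0..<m]" for r
  define unshift where "unshift xs = map (\<lambda>i. xs ! i - d i) [0..<m]" for xs
  define rows where "rows ys = map (\<lambda>i. length (filter (\<lambda>x. i < x) ys)) [0..<m]" for ys :: "nat list"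
  have col: "col xs = conjugate (unshift xs)" if "length xs = m" for xs
    using that by (simp add: col_def unshift_def d_def)
  have d_Suc: "d i = d (Suc i) + 2" if "Suc i < m" for i
    using that by (simp add: d_def)
  have d_pos: "0 < d i" if "i < m" for i
    using that by (simp add: d_def)
  have unshift_shift: "unshift (shift r) = r" if "length r = m" for r
    using that by (simp add: unshift_def shift_def list_eq_iff_nth_eq)
  have shift_unshift: "shift (unshift xs) = xs" if "xs \<in> Diff2" "length xs = m" for xs
  proof -
    have "d i \<le> xs ! i" if "i < m" for i
      using that Diff2_nth_ge[OF \<open>xs \<in> Diff2\<close>, of i] \<open>length xs = m\<close> by (simp add: d_def)
    then show ?thesis
      using that by (simp add: unshift_def shift_def list_eq_iff_nth_eq)
  qed
  have sum_shift: "sum_list (shift r) = sum_list r + m * m" if "length r = m" for r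
  proof -
    have "(\<Sum>i<m. d i) = m * m" unfolding d_def by (rule sum_odd_descending)
    with that show ?thesis
      by (simp add: shift_def sum_list_sum_nth sum.distrib atLeast0LessThan)
  qed
  have sorted_iff: "sorted_wrt (\<ge>) r \<longleftrightarrow> (\<forall>i. Suc i < length r \<longrightarrow> r ! Suc i \<le> r ! i)" for r :: "nat list"
    by (rule sorted_wrt_iff_nth_Suc_transp) (auto simp: transp_def)
  have sorted_unshift: "sorted_wrt (\<ge>) (unshift xs)" if "xs \<in> Diff2" "length xs = m" for xs
    unfolding sorted_iff
  proof (intro allI impI)
    fix i
    assume "Suc i < length (unshift xs)"
    then have i: "Suc i < m" by (simp add: unshift_def)
    with that have "xs ! Suc i + 2 \<le> xs ! i" by (simp add: Diff2_def)
    with i show "unshift xs ! Suc i \<le> unshift xs ! i"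
      using d_Suc[OF i] by (simp add: unshift_def)
  qed
  have shift_Diff2: "shift r \<in> Diff2" if "sorted_wrt (\<ge>) r" "length r = m" for r
  proof -
    have gap: "shift r ! Suc i + 2 \<le> shift r ! i" if i: "Suc i < length (shift r)" for i
    proof -
      have "Suc i < m" using i by (simp add: shift_def)
      moreover from this have "r ! Suc i \<le> r ! i"
        using \<open>sorted_wrt (\<ge>) r\<close> \<open>length r = m\<close> by (simp add: sorted_iff)
      ultimately show ?thesis using d_Suc[of i] by (simp add: shift_def)
    qed
    then have "sorted_wrt (\<ge>) (shift r)"
      unfolding sorted_iff by (meson add_leD1)
    moreover have "\<forall>x\<in>set (shift r). 0 < x"
      using d_pos by (auto simp: shift_def)
    ultimately show ?thesis using gap by (simp add: Diff2_def is_partition_def)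
  qed
  have len: "length (unshift xs) = m" "length (rows ys) = m" "length (shift r) = m" for xs ys r
    by (simp_all add: unshift_def rows_def shift_def)
  show ?thesis
  proof (rule bij_betw_byWitness[where f' = "\<lambda>ys. shift (rows ys)"])
    show "\<forall>xs\<in>{xs \<in> Diff2. length xs = m \<and> sum_list xs = N}. shift (rows (col xs)) = xs"
    proof
      fix xs
      assume "xs \<in> {xs \<in> Diff2. length xs = m \<and> sum_list xs = N}"
      then have xs: "xs \<in> Diff2" "length xs = m" by auto
      have "rows (col xs) = unshift xs"
        using column_lengths_conjugate[OF sorted_unshift[OF xs]] by (simp add: rows_def col xs len)
      then show "shift (rows (col xs)) = xs" using shift_unshift[OF xs] by simp
    qed
    show "\<forall>ys\<in>{ys. sorted_wrt (\<ge>) ys \<and> set ys \<subseteq> {1..m} \<and> sum_list ys + m * m = N}.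
        col (shift (rows ys)) = ys"
    proof
      fix ys
      assume "ys \<in> {ys. sorted_wrt (\<ge>) ys \<and> set ys \<subseteq> {1..m} \<and> sum_list ys + m * m = N}"
      then have "conjugate (rows ys) = ys"
        unfolding rows_def by (intro conjugate_column_lengths) auto
      then show "col (shift (rows ys)) = ys" by (simp add: col unshift_shift len)
    qed
    show "col ` {xs \<in> Diff2. length xs = m \<and> sum_list xs = N}
        \<subseteq> {ys. sorted_wrt (\<ge>) ys \<and> set ys \<subseteq> {1..m} \<and> sum_list ys + m * m = N}"
    proof (clarify, intro conjI)
      fix xs
      assume xs: "xs \<in> Diff2" "m = length xs" "N = sum_list xs"
      note s = sorted_unshift[OF xs(1) xs(2)[symmetric]]
      note c = col[OF xs(2)[symmetric]]
      show "sorted_wrt (\<ge>) (col xs)" using sorted_conjugate[OF s] by (simp only: c)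
      show "set (col xs) \<subseteq> {1..length xs}" using set_conjugate[OF s]
          by (simp only: c len xs(2)[symmetric])
      have "sum_list (col xs) + m * m = sum_list (shift (unshift xs))"
        by (simp add: c sum_list_conjugate sum_shift len)
      then show "sum_list (col xs) + length xs * length xs = sum_list xs"
        using shift_unshift[OF xs(1)] xs(2) by simp
    qed
    show "(\<lambda>ys. shift (rows ys)) ` {ys. sorted_wrt (\<ge>) ys \<and> set ys \<subseteq> {1..m} \<and> sum_list ys + m * m = N}
        \<subseteq> {xs \<in> Diff2. length xs = m \<and> sum_list xs = N}"
    proof clarify
      fix ys
      assume ys: "sorted_wrt (\<ge>) ys" "set ys \<subseteq> {1..m}"
      have "sum_list (rows ys) = sum_list ys"
        using conjugate_column_lengths[OF ys] sum_list_conjugate[of "rows ys"] by (simp add: rows_def)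
      moreover have "sorted_wrt (\<ge>) (rows ys)"
        unfolding rows_def by (rule sorted_wrt_ge_column_lengths)
      ultimately show "shift (rows ys) \<in> Diff2 \<and> length (shift (rows ys)) = m \<and>
          sum_list (shift (rows ys)) = sum_list ys + m * m"
        by (simp add: shift_Diff2 sum_shift len)
    qed
  qed
qed

section \<open>Counting \<open>Diff2\<close> by the multiplicities of the columns\<close>

lemma bij_betw_mset_sorted: "bij_betw mset {ys :: nat list. sorted_wrt (\<ge>) ys \<and> P (mset ys)} {\<nu>. P \<nu>}"
proof (rule bij_betw_byWitness[where f' = "\<lambda>\<nu>. rev (sorted_list_of_multiset \<nu>)"])
  have "rev (sort ys) = ys" if "sorted_wrt (\<ge>) ys" for ys :: "nat list"
  proof -
    from that have "sorted (rev ys)" by (simp add: sorted_wrt_rev)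
    then have "sort ys = rev ys" by (intro properties_for_sort) simp_all
    then show ?thesis by simp
  qed
  then show "\<forall>ys\<in>{ys. sorted_wrt (\<ge>) ys \<and> P (mset ys)}. rev (sorted_list_of_multiset (mset ys)) = ys"
    by simp
qed (auto simp: sorted_wrt_rev)

lemma card_sorted_eq_card_mset:
  "card {ys :: nat list. sorted_wrt (\<ge>) ys \<and> P (mset ys)} = card {\<nu>. P \<nu>}"
  by (rule bij_betw_same_card[OF bij_betw_mset_sorted])

lemma card_Diff2_col:
  "card {xs \<in> Diff2. length xs = m \<and> sum_list xs = N \<and> P (mset (col xs))} =
    (if N < m * m then 0 else card {\<nu> \<in> mset_parts {1..m} (N - m * m). P \<nu>})"
proof -
  let ?A = "{xs \<in> Diff2. length xs = m \<and> sum_list xs = N}"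
  let ?B = "{ys. sorted_wrt (\<ge>) ys \<and> set ys \<subseteq> {1..m} \<and> sum_list ys + m * m = N}"
  have "inj_on col ?A" "col ` ?A = ?B"
    using bij_betw_col[of m N] by (auto simp: bij_betw_def)
  then have "bij_betw col {xs \<in> ?A. P (mset (col xs))} {ys \<in> ?B. P (mset ys)}"
    unfolding bij_betw_def by (auto intro: inj_on_subset)
  then have "card {xs \<in> ?A. P (mset (col xs))} = card {ys \<in> ?B. P (mset ys)}"
    by (rule bij_betw_same_card)
  also have "{ys \<in> ?B. P (mset ys)} = {ys. sorted_wrt (\<ge>) ys \<and>
      (set_mset (mset ys) \<subseteq> {1..m} \<and> sum_mset (mset ys) + m * m = N \<and> P (mset ys))}"
    by (auto simp: sum_mset_sum_list)
  also have "card \<dots> = card {\<nu>. set_mset \<nu> \<subseteq> {1..m} \<and> sum_mset \<nu> + m * m = N \<and> P \<nu>}"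
    by (rule card_sorted_eq_card_mset)
  also have "{\<nu>. set_mset \<nu> \<subseteq> {1..m} \<and> sum_mset \<nu> + m * m = N \<and> P \<nu>} =
      (if N < m * m then {} else {\<nu> \<in> mset_parts {1..m} (N - m * m). P \<nu>})"
    by (auto simp: mset_parts_def)
  finally show ?thesis by (simp add: conj_ac cong: conj_cong)
qed

lemma card_Diff2_col_two_counts:
  assumes "1 < b" and "b \<le> m"
  shows "int (card {xs \<in> Diff2. length xs = m \<and> sum_list xs = N \<and>
      count_list (col xs) 1 = j \<and> count_list (col xs) b = l}) =
    fps_nth (fps_X ^ (m * m) * (fps_X ^ (j + l * b) * ((1 - fps_X) *
        (1 - fps_X ^ b) * parts_fps {1..m}))) N"
proof -
  have "card {xs \<in> Diff2. length xs = m \<and> sum_list xs = N \<and>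
      count_list (col xs) 1 = j \<and> count_list (col xs) b = l} =
    (if N < m * m then 0 else card {\<nu> \<in> mset_parts {1..m} (N - m * m). count \<nu> 1 = j \<and> count \<nu> b = l})"
    using card_Diff2_col[of m N "\<lambda>\<nu>. count \<nu> 1 = j \<and> count \<nu> b = l"] by (simp only: count_mset)
  moreover have "int (card {\<nu> \<in> mset_parts {1..m} (N - m * m). count \<nu> 1 = j \<and> count \<nu> b = l}) =
      fps_nth (fps_X ^ (j + l * b) * ((1 - fps_X) * (1 - fps_X ^ b) * parts_fps {1..m})) (N - m * m)"
    using card_mset_parts_two_counts[of "{1..m}" 1 b "N - m * m" j l] assms by simp
  ultimately show ?thesis
    by (simp add: fps_X_power_mult_nth[of "m * m"])
qed

text \<open>In a weakly decreasing list over 1 and 2 all 2s precede all 1s. This translates the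
  shape demanded of two-part partitions into multiplicities.\<close>

lemma eq_replicate_iff_counts:
  assumes "sorted_wrt (\<ge>) ys" and "set ys \<subseteq> {1..2::nat}"
  shows "ys = replicate l 2 @ replicate j 1 \<longleftrightarrow> count_list ys 1 = j \<and> count_list ys 2 = l"
proof -
  have count: "count_list (replicate n a) x = (if x = a then n else 0)" for n and a x :: nat
    by (induction n) auto
  have "ys = replicate (count_list ys 2) 2 @ replicate (count_list ys 1) 1"
    using assms
  proof (induction ys)
    case (Cons y ys)
    then have IH: "ys = replicate (count_list ys 2) 2 @ replicate (count_list ys 1) 1" by simp
    consider "y = 2" | "y = 1" using Cons.prems by force
    then show ?case
    proof cases
      case 1
      then show ?thesis using IH by simp
    next
      case 2
      with Cons.prems have "\<forall>x\<in>set ys. x = 1" by force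
      then have "count_list ys 2 = 0" by (auto simp: count_list_0_iff)
      then show ?thesis using IH 2 by simp
    qed
  qed simp
  then show ?thesis by (auto simp: count)
qed

lemma card_eq_sum_card_fibres:
  assumes "finite A" and "finite L" and "\<And>x. x \<in> A \<Longrightarrow> f x \<in> L"
  shows "card A = (\<Sum>l\<in>L. card {x \<in> A. f x = l})"
proof -
  have "A = (\<Union>l\<in>L. {x \<in> A. f x = l})" using assms(3) by auto
  also have "card \<dots> = (\<Sum>l\<in>L. card {x \<in> A. f x = l})"
    using assms(1,2) by (intro card_UN_disjoint) auto
  finally show ?thesis .
qed

text \<open>The sum telescopes. With M = 2h it trades the factor 1 - q^M for 1 - q^2 and an interval
  of h exponents; \<open>0 < h\<close> ensures that the truncated bound \<open>a + h - 1\<close>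
  describes h indices.\<close>

lemma sum_power_two_interval:
  fixes x :: "'a :: comm_ring_1"
  assumes "0 < h"
  shows "(\<Sum>l=a..a + h - 1. x ^ (2 * l)) * (1 - x ^ 2) = x ^ (2 * a) * (1 - x ^ (2 * h))"
  using assms
proof (induction h rule: nat_induct_non_zero)
  case 1
  then show ?case by simp
next
  case (Suc h)
  then have "{a..a + Suc h - 1} = insert (a + h) {a..a + h - 1}" by auto
  with Suc have "(\<Sum>l=a..a + Suc h - 1. x ^ (2 * l)) * (1 - x ^ 2) =
      x ^ (2 * (a + h)) * (1 - x ^ 2) + x ^ (2 * a) * (1 - x ^ (2 * h))"
    by (subst (1) \<open>{a..a + Suc h - 1} = _\<close>, subst sum.insert) (auto simp: distrib_right)
  then show ?case by (simp add: algebra_simps power_add power2_eq_square)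
qed

lemma finite_partition_subset: "A \<subseteq> partitions N \<Longrightarrow> finite A"
  using finite_partitions finite_subset by blast

lemma Diff2_partitions: "{xs \<in> Diff2. sum_list xs = N \<and> P xs} \<subseteq> partitions N"
  by (auto simp: Diff2_def partitions_def)

section \<open>Comparison of coefficients for each number of parts\<close>

theorem corollary2:
  fixes M N k j :: nat
  assumes "M \<ge> 4" and "even M" and "M mod 5 = 1 \<or> M mod 5 = 4" and "N \<ge> 1"
  shows
    "card {xs \<in> partitions N. (\<forall>x\<in>set xs. x mod 5 = 1 \<or> x mod 5 = 4) \<and>
        count_list xs M = k \<and> count_list xs 1 = j}
     = card {xs \<in> Diff2. sum_list xs = N \<and>
        (length xs = 1 \<and> N = j \<and> k = 0
         \<or> length xs = 2 \<and>
             (\<exists>l. col xs = replicate l 2 @ replicate j 1 \<and>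
               ((\<exists>i. i \<le> M div 2 - 1 \<and> i \<noteq> M div 2 - 2 \<and> l = M * k div 2 + i)
                \<or> k \<ge> 1 \<and> l = M * k div 2 - 2))
         \<or> 3 \<le> length xs \<and> length xs \<le> M - 1 \<and> count_list (col xs) 1 = j \<and>
             M * k div 2 \<le> count_list (col xs) 2 \<and>
             count_list (col xs) 2 \<le> M * k div 2 + M div 2 - 1
         \<or> M \<le> length xs \<and> count_list (col xs) 1 = j \<and> count_list (col xs) M = k)}"
    (is "card ?L = card {xs \<in> Diff2. sum_list xs = N \<and> ?Q xs}")
proof -
  obtain h where M: "M = 2 * h" using \<open>even M\<close> by (rule evenE)
  with \<open>M \<ge> 4\<close> have h: "2 \<le> h" by simp
  define X :: "int fps" where "X = fps_X"
  define S where "S = {i :: nat. i mod 5 = 1 \<or> i mod 5 = 4}"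
  define W where "W = X ^ (j + k * M) * ((1 - X) * (1 - X ^ M))"
  define t where "t m = W * (X ^ (m * m) * parts_fps {1..m})" for m
  define I where "I = {h * k..h * k + h - 1}"
  \<comment> \<open>The values of l in case (2): the second-largest element of \<open>I\<close> is
    replaced by \<open>h * k - 2\<close>. For k = 0 nothing is added, as the subtraction would be
    truncated.\<close>
  define I2 where "I2 = (I - {h * k + h - 2}) \<union> (if k \<ge> 1 then {h * k - 2} else {})"
  define D where "D m = {xs \<in> Diff2. sum_list xs = N \<and> ?Q xs \<and> length xs = m}" for m
  have Mk: "M * k div 2 = h * k" "M div 2 = h" "k * M = 2 * (h * k)" by (simp_all add: M)
  have S0: "0 \<notin> S" by (simp add: S_def)
  have "?L = {xs. sorted_wrt (\<ge>) xs \<and> (mset xs \<in> mset_parts S N \<and> count (mset xs) 1 =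
      j \<and> count (mset xs) M = k)}"
    using S0 by (force simp: partitions_def is_partition_def mset_parts_def S_def sum_mset_sum_list count_mset)
  then have "card ?L = card {\<nu> \<in> mset_parts S N. count \<nu> 1 = j \<and> count \<nu> M = k}"
    using card_sorted_eq_card_mset[of "\<lambda>\<nu>. \<nu> \<in> mset_parts S N \<and> count \<nu> 1 = j \<and> count \<nu> M = k"] by simp
  then have "int (card ?L) = fps_nth (W * parts_fps S) N"
    using card_mset_parts_two_counts[of S 1 M N j k] S0 assms by (simp add: S_def W_def X_def mult.assoc)
  \<comment> \<open>Agreement modulo \<open>X ^ Suc N\<close> reaches the coefficient of index
    \<open>N\<close>, hence the bound \<open>2 * Suc N\<close>.\<close>
  also have "\<dots> = fps_nth (\<Sum>m\<le>2 * Suc N. t m) N"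
    using agree_mult[OF agree_refl[of "Suc N" W] agree_sym[OF rogers_ramanujan[of "Suc N"]]]
    by (simp add: agree_def t_def X_def S_def flip: sum_distrib_left del: mult_Suc_right)
  finally have lhs: "int (card ?L) = (\<Sum>m\<le>2 * Suc N. fps_nth (t m) N)"
    by (simp only: fps_sum_nth)
  have finD: "finite {xs \<in> Diff2. sum_list xs = N \<and> P xs}" for P
    by (rule finite_partition_subset[OF Diff2_partitions])
  \<comment> \<open>Positive parts bound their number by \<open>N\<close>, so the range of summation
    on the other side covers every fibre.\<close>
  have len: "length xs \<le> sum_list xs" if "xs \<in> Diff2" for xs
  proof -
    have "\<forall>x\<in>set xs. 0 < x" using that by (simp add: Diff2_def is_partition_def)
    then show ?thesis by (induction xs) auto
  qed
  have "card {xs \<in> Diff2. sum_list xs = N \<and> ?Q xs} =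
      (\<Sum>m\<le>2 * Suc N. card {xs \<in> {xs \<in> Diff2. sum_list xs = N \<and> ?Q xs}. length xs = m})"
  proof (rule card_eq_sum_card_fibres[OF finD])
    fix xs
    assume "xs \<in> {xs \<in> Diff2. sum_list xs = N \<and> ?Q xs}"
    then show "length xs \<in> {..2 * Suc N}" using len[of xs] by auto
  qed simp
  also have "\<dots> = (\<Sum>m\<le>2 * Suc N. card (D m))"
    by (rule sum.cong[OF refl], rule arg_cong[where f = card]) (unfold D_def, blast)
  finally have rhs: "int (card {xs \<in> Diff2. sum_list xs = N \<and> ?Q xs}) = (\<Sum>m\<le>2 * Suc N. int (card (D m)))"
    by simp
  have two_counts: "int (card {xs \<in> Diff2. length xs = m \<and> sum_list xs = N \<and>
      count_list (col xs) 1 = j \<and> count_list (col xs) 2 \<in> L}) =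
      fps_nth (X ^ (m * m) * (X ^ j * (\<Sum>l\<in>L. X ^ (2 * l)) * ((1 - X) *
          (1 - X ^ 2) * parts_fps {1..m}))) N"
    if "2 \<le> m" "finite L" for m L
  proof -
    have "card {xs \<in> Diff2. length xs = m \<and> sum_list xs = N \<and> count_list (col xs) 1 =
        j \<and> count_list (col xs) 2 \<in> L}
      = (\<Sum>l\<in>L. card {xs \<in> {xs \<in> Diff2. length xs = m \<and> sum_list xs = N \<and> count_list (col xs) 1 =
          j \<and> count_list (col xs) 2 \<in> L}. count_list (col xs) 2 = l})"
      using \<open>finite L\<close>
      by (intro card_eq_sum_card_fibres) (auto intro: finite_subset[OF _ finD[of "\<lambda>_. True"]])
    also have "\<dots> = (\<Sum>l\<in>L. card {xs \<in> Diff2. length xs = m \<and> sum_list xs =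
        N \<and> count_list (col xs) 1 = j \<and> count_list (col xs) 2 = l})"
      by (rule sum.cong[OF refl], rule arg_cong[where f = card]) blast
    finally have "int (card {xs \<in> Diff2. length xs = m \<and> sum_list xs = N \<and> count_list (col xs) 1 =
        j \<and> count_list (col xs) 2 \<in> L})
      = (\<Sum>l\<in>L. fps_nth (X ^ (m * m) * (X ^ (j + l * 2) * ((1 - X) * (1 - X ^ 2) * parts_fps {1..m}))) N)"
      using card_Diff2_col_two_counts[of 2 m N j] \<open>2 \<le> m\<close> by (simp add: X_def)
    also have "\<dots> = fps_nth (\<Sum>l\<in>L. X ^ (m * m) * (X ^ (j + l * 2) * ((1 - X) *
        (1 - X ^ 2) * parts_fps {1..m}))) N"
      by (simp only: fps_sum_nth)
    also have "(\<Sum>l\<in>L. X ^ (m * m) * (X ^ (j + l * 2) * ((1 - X) * (1 - X ^ 2) * parts_fps {1..m}))) =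
        X ^ (m * m) * (X ^ j * (\<Sum>l\<in>L. X ^ (2 * l)) * ((1 - X) * (1 - X ^ 2) * parts_fps {1..m}))"
      unfolding sum_distrib_left sum_distrib_right
          by (intro sum.cong refl) (simp only: power_add mult_ac)
    finally show ?thesis .
  qed
  have geometric: "(\<Sum>l\<in>I. X ^ (2 * l)) * (1 - X ^ 2) = X ^ (k * M) * (1 - X ^ M)"
    unfolding I_def Mk(3) unfolding M using h sum_power_two_interval[of h X "h * k"] by simp
  \<comment> \<open>For m < M no column has length \<open>M\<close>; \<open>geometric\<close>
    exchanges the factor \<open>1 - X ^ M\<close> for \<open>1 - X ^ 2\<close>, which does cancel a
    part. For m at least \<open>M\<close> the part \<open>M\<close> itself is available.\<close>
  have large: "int (card (D m)) = fps_nth (t m) N" if "3 \<le> m" for m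
  proof (cases "m < M")
    case True
    then have "D m = {xs \<in> Diff2. length xs = m \<and> sum_list xs = N \<and> count_list (col xs) 1 =
        j \<and> count_list (col xs) 2 \<in> I}"
      using that by (auto simp: D_def I_def Mk)
    moreover have "X ^ (m * m) * (X ^ j * (\<Sum>l\<in>I. X ^ (2 * l)) * ((1 - X) *
        (1 - X ^ 2) * parts_fps {1..m})) = t m"
    proof -
      have "X ^ (m * m) * (X ^ j * (\<Sum>l\<in>I. X ^ (2 * l)) * ((1 - X) * (1 - X ^ 2) * parts_fps {1..m})) =
          X ^ (m * m) * (X ^ j * ((\<Sum>l\<in>I. X ^ (2 * l)) * (1 - X ^ 2)) * ((1 - X) * parts_fps {1..m}))"
        by (simp only: mult_ac)
      also have "\<dots> = t m"
        unfolding geometric t_def W_def power_add by (simp only: mult_ac)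
      finally show ?thesis .
    qed
    moreover have "finite I" by (simp add: I_def)
    ultimately show ?thesis
      using two_counts[of m I] that by simp
  next
    case False
    then have "D m = {xs \<in> Diff2. length xs = m \<and> sum_list xs = N \<and> count_list (col xs) 1 =
        j \<and> count_list (col xs) M = k}"
      using that \<open>M \<ge> 4\<close> by (auto simp: D_def)
    moreover have "X ^ (m * m) * (X ^ (j + k * M) * ((1 - X) * (1 - X ^ M) * parts_fps {1..m})) = t m"
      by (simp only: t_def W_def mult_ac)
    ultimately show ?thesis
      using card_Diff2_col_two_counts[of M m N j k] False \<open>M \<ge> 4\<close> by (simp add: X_def)
  qed
  \<comment> \<open>When only columns of length 1 and 2 occur, fixing both multiplicities leaves a
    single partition.\<close>
  have p2: "(1 - X) * (1 - X ^ 2) * parts_fps {1..2} = 1"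
  proof -
    have "{1..2} = {1, 2 :: nat}" by auto
    then show ?thesis using parts_fps_Un[of "{1, 2}" "{}"] by (simp add: X_def mult_ac)
  qed
  \<comment> \<open>The empty partition satisfies no case, so \<open>t 0\<close> has to be matched
    by partitions with one or two parts.\<close>
  have D0: "D 0 = {}"
    using \<open>M \<ge> 4\<close> by (auto simp: D_def)
  have D1: "int (card (D 1)) = fps_nth (if k = 0 then X ^ j else 0) N"
  proof -
    have "D 1 = (if N = j \<and> k = 0 then {[N]} else {})"
      using \<open>N \<ge> 1\<close> \<open>M \<ge> 4\<close> by (auto simp: D_def Diff2_def is_partition_def length_Suc_conv)
    then show ?thesis by (simp add: X_def)
  qed
  have D2: "int (card (D 2)) = fps_nth (X ^ 4 * (X ^ j * (\<Sum>l\<in>I2. X ^ (2 * l)))) N"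
  proof -
    have mem: "l \<in> I2 \<longleftrightarrow> (\<exists>i. i \<le> M div 2 - 1 \<and> i \<noteq> M div 2 - 2 \<and> l = M * k div 2 + i)
                \<or> k \<ge> 1 \<and> l = M * k div 2 - 2" for l
    proof -
      have "l \<in> I - {h * k + h - 2} \<longleftrightarrow> (\<exists>i. i \<le> h - 1 \<and> i \<noteq> h - 2 \<and> l = h * k + i)"
      proof
        assume "l \<in> I - {h * k + h - 2}"
        then show "\<exists>i. i \<le> h - 1 \<and> i \<noteq> h - 2 \<and> l = h * k + i"
          using h by (intro exI[of _ "l - h * k"]) (auto simp: I_def)
      qed (use h in \<open>auto simp: I_def\<close>)
      then show ?thesis by (simp add: I2_def Mk)
    qed
    \<comment> \<open>Two rows allow only columns of length 1 and 2, so the multiplicities determine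
      \<open>col xs\<close>.\<close>
    have "(\<exists>l. col xs = replicate l 2 @ replicate j 1 \<and> l \<in> I2) \<longleftrightarrow> count_list (col xs) 1 =
        j \<and> count_list (col xs) 2 \<in> I2"
      if "xs \<in> Diff2" "length xs = 2" "sum_list xs = N" for xs
    proof -
      have "sorted_wrt (\<ge>) (col xs)" "set (col xs) \<subseteq> {1..2}"
        using bij_betw_apply[OF bij_betw_col[of 2 N], of xs] that by auto
      then show ?thesis by (simp only: eq_replicate_iff_counts) blast
    qed
    then have "D 2 = {xs \<in> Diff2. length xs = 2 \<and> sum_list xs = N \<and> count_list (col xs) 1 =
        j \<and> count_list (col xs) 2 \<in> I2}"
      using \<open>M \<ge> 4\<close> unfolding D_def mem[symmetric] by auto
    moreover have "finite I2" by (simp add: I2_def I_def)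
    ultimately show ?thesis
      using two_counts[of 2 I2] p2 by simp
  qed
  have small: "(if k = 0 then X ^ j else 0) + X ^ 4 * (X ^ j * (\<Sum>l\<in>I2. X ^ (2 * l))) = t 0 + t 1 + t 2"
  proof -
    define T where "T = (\<Sum>l\<in>I. X ^ (2 * l))"
    define B where "B = (if k \<ge> 1 then X ^ (2 * (h * k - 2)) else 0)"
    \<comment> \<open>For positive k the value \<open>h * k - 2\<close> is an exact difference,
      hence lies strictly below the interval \<open>I\<close>.\<close>
    have hk: "2 \<le> h * k" if "k \<ge> 1" using that h by (metis mult_le_mono nat_mult_1_right)
    have "(\<Sum>l\<in>I2. X ^ (2 * l)) =
        (\<Sum>l\<in>I - {h * k + h - 2}. X ^ (2 * l)) + (\<Sum>l\<in>(if k \<ge> 1 then {h * k - 2} else {}). X ^ (2 * l))"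
      unfolding I2_def using hk by (intro sum.union_disjoint) (auto simp: I_def)
    also have "(\<Sum>l\<in>I - {h * k + h - 2}. X ^ (2 * l)) = T - X ^ (2 * (h * k + h - 2))"
      unfolding T_def using h by (subst sum_diff1) (auto simp: I_def)
    also have "(\<Sum>l\<in>(if k \<ge> 1 then {h * k - 2} else {}). X ^ (2 * l)) = B"
      by (simp add: B_def)
    finally have I2: "(\<Sum>l\<in>I2. X ^ (2 * l)) = T - X ^ (2 * (h * k + h - 2)) + B" .
    have p1: "(1 - X) * parts_fps {1..1} = 1"
      using parts_fps_insert[of 1 "{}"] by (simp add: X_def mult_ac)
    have "t 2 = X ^ 4 * (X ^ j * (X ^ (k * M) * (1 - X ^ M))) * ((1 - X) * parts_fps {1..2})"
      by (simp add: t_def W_def power_add mult_ac)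
    also have "\<dots> = X ^ 4 * (X ^ j * T) * ((1 - X) * (1 - X ^ 2) * parts_fps {1..2})"
      unfolding geometric[symmetric] T_def by (simp only: mult_ac)
    finally have t2: "t 2 = X ^ 4 * (X ^ j * T)" by (simp only: p2 mult_1_right)
    have "t 1 = X ^ (j + k * M) * (1 - X ^ M) * X * ((1 - X) * parts_fps {1..1})"
      by (simp add: t_def W_def mult_ac)
    then have t1: "t 1 = X ^ (j + k * M) * (1 - X ^ M) * X" by (simp only: p1 mult_1_right)
    have t0: "t 0 = X ^ (j + k * M) * (1 - X ^ M) * (1 - X)"
      by (simp add: t_def W_def mult_ac)
    \<comment> \<open>The 4 is \<open>m * m\<close> for m = 2. The deleted value has total exponent
      \<open>k * M + M\<close>, the negative term of \<open>t 0 + t 1\<close> apart from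
      \<open>X ^ j\<close>.\<close>
    have "X ^ 4 * X ^ (2 * (h * k + h - 2)) = X ^ (k * M) * X ^ M"
      using h unfolding power_add[symmetric] by (intro arg_cong[where f =
          "power X"]) (simp add: Mk, simp add: M)
    \<comment> \<open>The added value has exponent \<open>k * M\<close>, matching the positive term
      of \<open>t 0 + t 1\<close>; for k = 0 that term is the one-part partition.\<close>
    moreover have "X ^ 4 * B = (if k = 0 then 0 else X ^ (k * M))"
    proof (cases "k = 0")
      case False
      then have "4 + 2 * (h * k - 2) = k * M" using hk by (simp add: Mk)
      then show ?thesis using False by (simp add: B_def flip: power_add)
    qed (simp add: B_def)
    moreover have "X ^ 4 * (X ^ j * (T - X ^ (2 * (h * k + h - 2)) + B)) =
        X ^ 4 * (X ^ j * T) - X ^ j * (X ^ 4 * X ^ (2 * (h * k + h - 2))) + X ^ j * (X ^ 4 * B)"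
      by (simp add: algebra_simps)
    moreover have "t 0 + t 1 = X ^ j * X ^ (k * M) - X ^ j * (X ^ (k * M) * X ^ M)"
      unfolding t0 t1 power_add by (simp add: algebra_simps)
    ultimately show ?thesis
      unfolding I2 t2 by (cases "k = 0") simp_all
  qed
  have split: "(\<Sum>m\<le>2 * Suc N. f m) = f 0 + f 1 + f 2 + (\<Sum>m=3..2 * Suc N. f m)" for f :: "nat \<Rightarrow> int"
  proof -
    have "{..2 * Suc N} = {0, 1, 2} \<union> {3..2 * Suc N}" by auto
    then show ?thesis by (simp add: sum.union_disjoint add.assoc)
  qed
  have "int (card (D 0)) + int (card (D 1)) + int (card (D 2)) =
      fps_nth (t 0) N + fps_nth (t 1) N + fps_nth (t 2) N"
    unfolding D1 D2 by (simp add: D0 small flip: fps_add_nth)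
  then have "int (card ?L) = int (card {xs \<in> Diff2. sum_list xs = N \<and> ?Q xs})"
    unfolding lhs rhs split by (simp add: large)
  then show ?thesis by simp
qed

end
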